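(* Let $\mathbb{K}$ be a field, let $G$ be a graph with vertex set $\{v_1,\dots,v_n\}$, and let $I=I(G)\subseteq S=\mathbb{K}[x_1,\dots,x_n]$ be its edge ideal. Assume that $H$ is a connected component of $G$ with at least one edge. Suppose that $h$ is the number of bipartite connected components of $G\setminus V(H)$. Then for every integer $k\geq 1$, we have $$\mathrm{sdepth}(I^k)\geq \min_{1\leq l\leq k}\{\mathrm{sdepth}_{S'}(I(H)^l)\}+h,$$ where $S'=\mathbb{K}[x_i\mid v_i\in V(H)]$ and $I(H)\subseteq S'$ is the edge ideal of $H$.
   Context: Graphs are finite and simple. The edge ideal of a graph is the ideal generated by the squarefree monomials $x_ix_j$ with $\{v_i,v_j\}$ an edge of the graph, in the polynomial ring over $\mathbb{K}$ whose variables $x_i$ correspond to the vertices $v_i$ of the graph. For $W\subseteq V(G)$, $G\setminus W$ is the graph obtained from $G$ by removing the vertices of $W$ and all edges containing a vertex of $W$. An isolated vertex counts as a bipartite connected component. If $G=H$, then $h=0$. Stanley depth: let $R$ be a polynomial ring over $\mathbb{K}$ in a finite set $X$ of variables, $M$ a finitely generated $\mathbb{Z}^{|X|}$-graded $R$-module, $u\in M$ a homogeneous element and $Z\subseteq X$. The $\mathbb{K}$-subspace $u\mathbb{K}[Z]$ generated by all $uv$ with $v\in\mathbb{K}[Z]$ is called a Stanley space of dimension $|Z|$ if it is a free $\mathbb{K}[Z]$-module. A Stanley decomposition $\mathcal{D}$ of $M$ is a decomposition of $M$ (as a $\mathbb{K}$-vector space) as a finite direct sum of Stanley spaces; $\mathrm{sdepth}(\mathcal{D})$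 is the minimum dimension of a Stanley space in $\mathcal{D}$, and $\mathrm{sdepth}_R(M)$ is the maximum of $\mathrm{sdepth}(\mathcal{D})$ over all Stanley decompositions $\mathcal{D}$ of $M$. Without subscript, $\mathrm{sdepth}=\mathrm{sdepth}_S$. *)

theory Defs
  imports
    "HOL-Library.FuncSet"
    "HOL-Library.Poly_Mapping"
    "HOL-Algebra.Ideal_Product"
    "Graph_Theory.Digraph_Component"
begin

section \<open>Polynomial rings\<close>

text \<open>
  A monomial is a finitely supported exponent vector, a polynomial a finitely supported
  coefficient function on monomials. Polynomial rings in different sets of variables are
  realised as subrings, with different carriers, of one type.
\<close>

type_synonym ('v, 'k) mpoly = "('v \<Rightarrow>\<^sub>0 nat) \<Rightarrow>\<^sub>0 'k"

definition poly_ring :: "'v set \<Rightarrow> ('v, 'k::field) mpoly ring" where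
  "poly_ring X =
     \<lparr> carrier = {p. \<forall>m \<in> Poly_Mapping.keys p. Poly_Mapping.keys m \<subseteq> X},
       monoid.mult = (*), one = 1, zero = 0, add = (+) \<rparr>"

definition var :: "'v \<Rightarrow> ('v, 'k::field) mpoly" where
  "var i = Poly_Mapping.single (Poly_Mapping.single i 1) 1"

text \<open>
  The \<open>\<int>\<^sup>X\<close>-grading of the polynomial ring has the one-dimensional components
  \<open>\<bbbK>x\<^sup>a\<close> for exponents \<open>a \<ge> 0\<close>, and zero components otherwise.
\<close>

definition homogeneous :: "('v, 'k::field) mpoly \<Rightarrow> bool" where
  "homogeneous u \<longleftrightarrow> (\<exists>a c. u = Poly_Mapping.single a c)"

lemma cring_poly_ring: "cring (poly_ring X :: ('v, 'k::field) mpoly ring)"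
proof (rule cringI)
  show "abelian_group (poly_ring X :: ('v, 'k) mpoly ring)"
  proof (rule abelian_groupI)
    fix x y :: "('v, 'k) mpoly"
    assume "x \<in> carrier (poly_ring X)" "y \<in> carrier (poly_ring X)"
    then show "x \<oplus>\<^bsub>poly_ring X\<^esub> y \<in> carrier (poly_ring X)"
      using Poly_Mapping.keys_add[of x y] by (auto simp: poly_ring_def)
  next
    fix x :: "('v, 'k) mpoly"
    assume "x \<in> carrier (poly_ring X)"
    then show "\<exists>y\<in>carrier (poly_ring X). y \<oplus>\<^bsub>poly_ring X\<^esub> x = \<zero>\<^bsub>poly_ring X\<^esub>"
      by (intro bexI[of _ "- x"]) (auto simp: poly_ring_def)
  qed (auto simp: poly_ring_def add_ac)
  show "comm_monoid (poly_ring X :: ('v, 'k) mpoly ring)"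
  proof (rule comm_monoidI)
    fix x y :: "('v, 'k) mpoly"
    assume "x \<in> carrier (poly_ring X)" "y \<in> carrier (poly_ring X)"
    then have "Poly_Mapping.keys m \<subseteq> X" if m: "m \<in> Poly_Mapping.keys (x * y)" for m
    proof -
      obtain a b where ab: "m = a + b" "a \<in> Poly_Mapping.keys x" "b \<in> Poly_Mapping.keys y"
        using m Poly_Mapping.keys_mult[of x y] by blast
      have "Poly_Mapping.keys a \<subseteq> X" "Poly_Mapping.keys b \<subseteq> X"
        using \<open>x \<in> _\<close> \<open>y \<in> _\<close> ab by (simp_all add: poly_ring_def)
      then show ?thesis
        using Poly_Mapping.keys_add[of a b] ab(1) by blast
    qed
    then show "x \<otimes>\<^bsub>poly_ring X\<^esub> y \<in> carrier (poly_ring X)"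
      by (simp add: poly_ring_def)
  qed (auto simp: poly_ring_def mult_ac)
qed (auto simp: poly_ring_def algebra_simps)


section \<open>Stanley depth\<close>

text \<open>
  An \<open>A\<close>-submodule \<open>U\<close> of the polynomial ring, for a subring \<open>A\<close>, is free if it has a
  subset \<open>B\<close> such that every element of \<open>U\<close> is a unique \<open>A\<close>-linear combination of \<open>B\<close>.
\<close>

definition free_over :: "('v, 'k::field) mpoly set \<Rightarrow> ('v, 'k) mpoly set \<Rightarrow> bool" where
  "free_over A U \<longleftrightarrow>
     (\<exists>B \<subseteq> U. \<forall>x \<in> U. \<exists>!c :: ('v, 'k) mpoly \<Rightarrow>\<^sub>0 ('v, 'k) mpoly.
        Poly_Mapping.keys c \<subseteq> B \<and> (\<forall>b. Poly_Mapping.lookup c b \<in> A) \<and>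
        x = (\<Sum>b \<in> Poly_Mapping.keys c. Poly_Mapping.lookup c b * b))"

text \<open>The set \<open>u\<bbbK>[Z]\<close>; it is already closed under \<open>\<bbbK>\<close>-linear combinations.\<close>

definition mult_space :: "('v, 'k::field) mpoly \<Rightarrow> 'v set \<Rightarrow> ('v, 'k) mpoly set" where
  "mult_space u Z = {u * v | v. v \<in> carrier (poly_ring Z)}"

definition stanley_space ::
    "'v set \<Rightarrow> ('v, 'k::field) mpoly set \<Rightarrow> ('v, 'k) mpoly \<Rightarrow> 'v set \<Rightarrow> bool" where
  "stanley_space X M u Z \<longleftrightarrow>
     u \<in> M \<and> homogeneous u \<and> Z \<subseteq> X \<and> free_over (carrier (poly_ring Z)) (mult_space u Z)"

text \<open>
  Here \<open>M\<close> is a multigraded submodule, that is a monomial ideal, of \<open>poly_ring X\<close>. A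
  decomposition is given by the finite set of the pairs \<open>(u, Z)\<close> of its Stanley spaces.
\<close>

definition stanley_decomposition ::
    "'v set \<Rightarrow> ('v, 'k::field) mpoly set \<Rightarrow> (('v, 'k) mpoly \<times> 'v set) set \<Rightarrow> bool" where
  "stanley_decomposition X M D \<longleftrightarrow>
     finite D \<and> (\<forall>(u, Z) \<in> D. stanley_space X M u Z \<and> mult_space u Z \<subseteq> M) \<and>
     (\<forall>x \<in> M. \<exists>!f. f \<in> (\<Pi>\<^sub>E (u, Z) \<in> D. mult_space u Z) \<and> x = (\<Sum>d \<in> D. f d))"

definition sdepth_decomposition :: "(('v, 'k::field) mpoly \<times> 'v set) set \<Rightarrow> nat" where
  "sdepth_decomposition D = Min ((\<lambda>(u, Z). card Z) ` D)"

text \<open>Only meaningful for \<open>M \<noteq> {0}\<close>, since \<open>Min\<close> is unspecified on the empty set.\<close>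

definition sdepth :: "'v set \<Rightarrow> ('v, 'k::field) mpoly set \<Rightarrow> nat" where
  "sdepth X M = Max {sdepth_decomposition D | D. stanley_decomposition X M D}"


section \<open>Graphs and edge ideals\<close>

text \<open>
  The locale \<open>graph\<close> describes finite simple graphs, each edge being encoded as a pair of
  opposite arcs. By this symmetry \<open>pre_digraph.sccs\<close> consists of the connected components.
\<close>

definition edge_ideal :: "('v, 'e) pre_digraph \<Rightarrow> ('v, 'k::field) mpoly set" where
  "edge_ideal G = Idl\<^bsub>poly_ring (verts G)\<^esub> {var u * var v | u v. u \<rightarrow>\<^bsub>G\<^esub> v}"

definition ideal_power ::
    "'v set \<Rightarrow> ('v, 'k::field) mpoly set \<Rightarrow> nat \<Rightarrow> ('v, 'k) mpoly set" where
  "ideal_power X I k = I [^]\<^bsub>ideals_set (poly_ring X)\<^esub> k"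

definition remove_verts :: "('v, 'e) pre_digraph \<Rightarrow> 'v set \<Rightarrow> ('v, 'e) pre_digraph" where
  "remove_verts G W = G \<restriction> (verts G - W)"

definition bipartite :: "('v, 'e) pre_digraph \<Rightarrow> bool" where
  "bipartite G \<longleftrightarrow>
     (\<exists>A B. A \<union> B = verts G \<and> A \<inter> B = {} \<and>
        (\<forall>u v. u \<rightarrow>\<^bsub>G\<^esub> v \<longrightarrow> u \<in> A \<and> v \<in> B \<or> u \<in> B \<and> v \<in> A))"

definition bipartite_components :: "('v, 'e) pre_digraph \<Rightarrow> ('v, 'e) pre_digraph set" where
  "bipartite_components G = {C \<in> pre_digraph.sccs G. bipartite C}"

end

theory Submission
  imports Defs
begin

text \<open>
  A Stanley decomposition of a monomial ideal is a partition of its exponent set into finitely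
  many cones $a + \mathbb{N}^Z$. Write $G = H \sqcup G'$ and $L = I(G')$. Sorting the monomials
  of $I^k$ by the power of $L$ that contains their $G'$-part yields
  $I^k = S' L^k \oplus \bigoplus_{j<k} I(H)^{k-j} (L^j / L^{j+1})$, so it suffices that $L^k$ and the
  layers $L^j / L^{j+1}$ have Stanley depth at least $h$. Layers of disjoint unions are sums of products
  of layers, which reduces the claim to one bipartite component. There Koenig's theorem gives
  for every exponent $a$ in the layer a cover of weight $j$, and raising a variable outside the cover
  does not leave the layer. Choosing for each $a$ the first such variable is stable along the ray,
  which gives a finite partition into cones of positive dimension.
\<close>

section \<open>Cone partitions of exponent sets\<close>

text \<open>The exponent sets involved are infinite, while a Stanley decomposition must be finite.
  Each set is therefore shown to be insensitive to capping all coordinates at some bound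
  \<open>g\<close>, so that only finitely many classes of exponents matter. The choice of a
  direction depends on the class alone, which makes the resulting family of cones finite.

  The minimum runs over 1 \<le> l \<le> k because a monomial whose part in the remaining graph lies
  in L^j but not in L^(j+1), with j < k, needs its other part in I(H)^(k-j). Once the first part
  lies in L^k, the other part is arbitrary, and S' has depth |V(H)|, which is no smaller than the
  minimum.

  Bipartiteness matters only for layers. A power of L is closed under multiplication by every
  variable, so a free direction is immediate; for a layer, staying outside L^(j+1) has to be
  certified, and a vertex cover is such a certificate.\<close>

definition monomials :: "'v set \<Rightarrow> ('v \<Rightarrow>\<^sub>0 nat) set" where
  "monomials X = {a. Poly_Mapping.keys a \<subseteq> X}"

definition cone :: "('v \<Rightarrow>\<^sub>0 nat) \<Rightarrow> 'v set \<Rightarrow> ('v \<Rightarrow>\<^sub>0 nat) set" where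
  "cone a Z = {a + b | b. b \<in> monomials Z}"

abbreviation unit_vec :: "'v \<Rightarrow> 'v \<Rightarrow>\<^sub>0 nat" where
  "unit_vec v \<equiv> Poly_Mapping.single v 1"

lemma monomials_iff: "a \<in> monomials X \<longleftrightarrow> (\<forall>v. v \<notin> X \<longrightarrow> Poly_Mapping.lookup a v = 0)"
  by (auto simp: monomials_def in_keys_iff)

lemma monomials_add_iff: "a + b \<in> monomials X \<longleftrightarrow> a \<in> monomials X \<and> b \<in> monomials X"
  by (auto simp: monomials_iff lookup_add)

lemma zero_monomials [simp]: "0 \<in> monomials X"
  by (simp add: monomials_iff)

lemma single_monomials_iff: "Poly_Mapping.single v n \<in> monomials X \<longleftrightarrow> v \<in> X \<or> n = 0"
  by (auto simp: monomials_iff lookup_single when_def)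

lemma cone_iff:
  "m \<in> cone a Z \<longleftrightarrow>
     (\<forall>v. Poly_Mapping.lookup a v \<le> Poly_Mapping.lookup m v) \<and>
     (\<forall>v. v \<notin> Z \<longrightarrow> Poly_Mapping.lookup m v = Poly_Mapping.lookup a v)"
proof
  assume R: "(\<forall>v. Poly_Mapping.lookup a v \<le> Poly_Mapping.lookup m v) \<and>
     (\<forall>v. v \<notin> Z \<longrightarrow> Poly_Mapping.lookup m v = Poly_Mapping.lookup a v)"
  then have "m = a + (m - a)" "m - a \<in> monomials Z"
    by (auto intro!: poly_mapping_eqI simp: lookup_add lookup_minus monomials_iff)
  then show "m \<in> cone a Z" unfolding cone_def by blast
qed (auto simp: cone_def lookup_add monomials_iff)

lemma self_in_cone [simp]: "a \<in> cone a Z"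
  by (simp add: cone_iff)

text \<open>The value type stays general because the same operation restricts an exponent to a set
  of variables and a polynomial to a set of monomials.\<close>

definition restrict_exp :: "'v set \<Rightarrow> ('v \<Rightarrow>\<^sub>0 'b::zero) \<Rightarrow> ('v \<Rightarrow>\<^sub>0 'b)" where
  "restrict_exp A a = Poly_Mapping.mapp (\<lambda>v n. n when v \<in> A) a"

lemma lookup_restrict_exp:
  "Poly_Mapping.lookup (restrict_exp A a) v = (Poly_Mapping.lookup a v when v \<in> A)"
  by (auto simp: restrict_exp_def lookup_mapp when_def in_keys_iff)

section \<open>Capping exponents at a bound\<close>

definition trunc_exp :: "nat \<Rightarrow> ('v \<Rightarrow>\<^sub>0 nat) \<Rightarrow> ('v \<Rightarrow>\<^sub>0 nat)" where
  "trunc_exp g a = Poly_Mapping.mapp (\<lambda>v n. min g n) a"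

lemma lookup_trunc_exp: "Poly_Mapping.lookup (trunc_exp g a) v = min g (Poly_Mapping.lookup a v)"
  by (auto simp: trunc_exp_def lookup_mapp when_def in_keys_iff)

lemma trunc_exp_eq_iff:
  "trunc_exp g a = trunc_exp g b \<longleftrightarrow>
     (\<forall>v. min g (Poly_Mapping.lookup a v) = min g (Poly_Mapping.lookup b v))"
  unfolding poly_mapping_eq_iff fun_eq_iff lookup_trunc_exp ..

lemma finite_trunc_exp_image:
  assumes "finite X" "A \<subseteq> monomials X"
  shows "finite (trunc_exp g ` A)"
proof -
  let ?F = "{f. \<forall>v. (v \<in> X \<longrightarrow> f v \<in> {..g}) \<and> (v \<notin> X \<longrightarrow> f v = (0::nat))}"
  have "finite ?F" by (rule finite_set_of_finite_funs) (use assms in auto)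
  moreover have "Poly_Mapping.lookup ` trunc_exp g ` A \<subseteq> ?F"
    using assms(2) by (auto simp: lookup_trunc_exp monomials_iff)
  ultimately have "finite (Poly_Mapping.lookup ` trunc_exp g ` A)" by (rule finite_subset[rotated])
  then show ?thesis
    by (rule finite_imageD) (simp add: inj_on_def lookup_inject)
qed

text \<open>Such a set is a union of classes of capped exponents. Unlike monomial ideals, these sets
  are closed under differences, as layers require.\<close>

definition trunc_invariant :: "nat \<Rightarrow> ('v \<Rightarrow>\<^sub>0 nat) set \<Rightarrow> bool" where
  "trunc_invariant g A \<longleftrightarrow> (\<forall>a b. trunc_exp g a = trunc_exp g b \<longrightarrow> a \<in> A \<longrightarrow> b \<in> A)"

lemma trunc_invariantD:
  assumes "trunc_invariant g A" "trunc_exp g a = trunc_exp g b"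
  shows "a \<in> A \<longleftrightarrow> b \<in> A"
  using assms(1)[unfolded trunc_invariant_def, rule_format, OF assms(2)]
    assms(1)[unfolded trunc_invariant_def, rule_format, OF assms(2)[symmetric]] by blast

text \<open>Coordinates that agree below \<open>g\<close>, or both reach it, keep doing so after a
  common shift. Conditions on translates of an exponent thus depend on its class alone.\<close>

lemma trunc_exp_add_cong:
  "trunc_exp g a = trunc_exp g b \<Longrightarrow> trunc_exp g (a + c) = trunc_exp g (b + c)"
  unfolding trunc_exp_eq_iff lookup_add
proof
  fix v
  assume *: "\<forall>v. min g (Poly_Mapping.lookup a v) = min g (Poly_Mapping.lookup b v)"
  show "min g (Poly_Mapping.lookup a v + Poly_Mapping.lookup c v)
      = min g (Poly_Mapping.lookup b v + Poly_Mapping.lookup c v)"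
    using spec[OF *, of v] by linarith
qed

section \<open>Partitions into finitely many cones\<close>

definition stanley_partition ::
    "'v set \<Rightarrow> ('v \<Rightarrow>\<^sub>0 nat) set \<Rightarrow> (('v \<Rightarrow>\<^sub>0 nat) \<times> 'v set) set \<Rightarrow> bool" where
  "stanley_partition X A D \<longleftrightarrow> finite D \<and> (\<forall>(a, Z) \<in> D. Z \<subseteq> X) \<and>
     disjoint_family_on (\<lambda>(a, Z). cone a Z) D \<and> A = (\<Union>(a, Z) \<in> D. cone a Z)"

lemma stanley_partitionI:
  assumes "finite D" "\<And>a Z. (a, Z) \<in> D \<Longrightarrow> Z \<subseteq> X"
    and "\<And>m a Z b W. (a, Z) \<in> D \<Longrightarrow> (b, W) \<in> D \<Longrightarrow> m \<in> cone a Z \<Longrightarrow> m \<in> cone b W \<Longrightarrow>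
           a = b \<and> Z = W"
    and "A = (\<Union>(a, Z) \<in> D. cone a Z)"
  shows "stanley_partition X A D"
proof -
  have "disjoint_family_on (\<lambda>(a, Z). cone a Z) D"
    unfolding disjoint_family_on_def
  proof (intro ballI impI)
    fix p q assume "p \<in> D" "q \<in> D" "p \<noteq> q"
    then show "(case p of (a, Z) \<Rightarrow> cone a Z) \<inter> (case q of (a, Z) \<Rightarrow> cone a Z) = {}"
      using assms(3)[of "fst p" "snd p" "fst q" "snd q"]
      by (cases p; cases q) auto
  qed
  then show ?thesis unfolding stanley_partition_def using assms by auto
qed

lemma stanley_partitionD:
  assumes "stanley_partition X A D"
  shows "finite D" "(a, Z) \<in> D \<Longrightarrow> Z \<subseteq> X" "A = (\<Union>(a, Z) \<in> D. cone a Z)"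
    and "(a, Z) \<in> D \<Longrightarrow> (b, W) \<in> D \<Longrightarrow> m \<in> cone a Z \<Longrightarrow> m \<in> cone b W \<Longrightarrow> a = b \<and> Z = W"
proof -
  show "a = b \<and> Z = W" if "(a, Z) \<in> D" "(b, W) \<in> D" "m \<in> cone a Z" "m \<in> cone b W"
  proof (rule ccontr)
    assume "\<not> (a = b \<and> Z = W)"
    then have "(a, Z) \<noteq> (b, W)" by simp
    then have "cone a Z \<inter> cone b W = {}"
      using assms that(1,2) unfolding stanley_partition_def disjoint_family_on_def
      by (metis (no_types, lifting) case_prod_conv)
    then show False using that(3,4) by blast
  qed
next
  show "finite D" "A = (\<Union>(a, Z) \<in> D. cone a Z)" "(a, Z) \<in> D \<Longrightarrow> Z \<subseteq> X"
    using assms unfolding stanley_partition_def by blast+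
qed

lemma stanley_partition_cone_subset:
  "stanley_partition X A D \<Longrightarrow> (a, Z) \<in> D \<Longrightarrow> cone a Z \<subseteq> A"
  by (auto simp: stanley_partition_def)

text \<open>A lower bound is tracked instead of a maximum since the pieces to be combined may be
  empty; the empty partition then satisfies every bound.\<close>

definition stanley_depth_ge :: "'v set \<Rightarrow> ('v \<Rightarrow>\<^sub>0 nat) set \<Rightarrow> nat \<Rightarrow> bool" where
  "stanley_depth_ge X A d \<longleftrightarrow> (\<exists>D. stanley_partition X A D \<and> (\<forall>(a, Z) \<in> D. d \<le> card Z))"

lemma stanley_depth_ge_mono: "stanley_depth_ge X A d \<Longrightarrow> e \<le> d \<Longrightarrow> stanley_depth_ge X A e"
  unfolding stanley_depth_ge_def by (metis (mono_tags, lifting) case_prodI2 case_prod_conv le_trans surj_pair)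

lemma stanley_depth_ge_empty: "stanley_depth_ge X {} d"
  unfolding stanley_depth_ge_def stanley_partition_def
  by (rule exI[of _ "{}"]) (simp add: disjoint_family_on_def)

lemma stanley_depth_ge_cone: "Z \<subseteq> X \<Longrightarrow> stanley_depth_ge X (cone a Z) (card Z)"
  unfolding stanley_depth_ge_def stanley_partition_def
  by (rule exI[of _ "{(a, Z)}"]) (simp add: disjoint_family_on_def)

lemma cone_zero: "cone 0 Z = monomials Z"
  by (auto simp: cone_def)

lemma stanley_depth_ge_monomials: "stanley_depth_ge X (monomials X) (card X)"
  using stanley_depth_ge_cone[of X X 0] by (simp add: cone_zero)

lemma stanley_depth_ge_Un:
  assumes "stanley_depth_ge X A d" "stanley_depth_ge X B d" "A \<inter> B = {}"
  shows "stanley_depth_ge X (A \<union> B) d"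
proof -
  obtain D where D: "stanley_partition X A D" "\<forall>(a, Z) \<in> D. d \<le> card Z"
    using assms(1) unfolding stanley_depth_ge_def by blast
  obtain E where E: "stanley_partition X B E" "\<forall>(a, Z) \<in> E. d \<le> card Z"
    using assms(2) unfolding stanley_depth_ge_def by blast
  have "stanley_partition X (A \<union> B) (D \<union> E)"
  proof (rule stanley_partitionI)
    fix m a Z b W
    assume *: "(a, Z) \<in> D \<union> E" "(b, W) \<in> D \<union> E" "m \<in> cone a Z" "m \<in> cone b W"
    have "m \<in> A \<Longrightarrow> m \<notin> B" using assms(3) by blast
    then have "(a, Z) \<in> D \<and> (b, W) \<in> D \<or> (a, Z) \<in> E \<and> (b, W) \<in> E"
      using * stanley_partition_cone_subset[OF D(1)] stanley_partition_cone_subset[OF E(1)] by blast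
    then show "a = b \<and> Z = W"
      using stanley_partitionD(4)[OF D(1) _ _ *(3,4)] stanley_partitionD(4)[OF E(1) _ _ *(3,4)] by blast
  next
    show "Z \<subseteq> X" if "(a, Z) \<in> D \<union> E" for a Z
      using that stanley_partitionD(2)[OF D(1)] stanley_partitionD(2)[OF E(1)] by blast
  qed (use stanley_partitionD(1,3)[OF D(1)] stanley_partitionD(1,3)[OF E(1)] in auto)
  then show ?thesis
    unfolding stanley_depth_ge_def using D(2) E(2) by blast
qed

lemma stanley_depth_ge_UN:
  assumes "finite T" "disjoint_family_on A T" "\<And>i. i \<in> T \<Longrightarrow> stanley_depth_ge X (A i) d"
  shows "stanley_depth_ge X (\<Union>i\<in>T. A i) d"
  using assms
proof (induction T rule: finite_induct)
  case (insert i T)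
  have "A i \<inter> (\<Union>j\<in>T. A j) = {}"
    using insert.prems(1) insert.hyps(2) unfolding disjoint_family_on_def by fastforce
  moreover have "disjoint_family_on A T"
    using insert.prems(1) unfolding disjoint_family_on_def by blast
  ultimately show ?case
    using insert by (auto intro!: stanley_depth_ge_Un)
qed (simp add: stanley_depth_ge_empty)

section \<open>Sums of exponent sets in disjoint variables\<close>

definition set_sum :: "'a::plus set \<Rightarrow> 'a set \<Rightarrow> 'a set" where
  "set_sum A B = {a + b | a b. a \<in> A \<and> b \<in> B}"

lemma set_sumI: "a \<in> A \<Longrightarrow> b \<in> B \<Longrightarrow> a + b \<in> set_sum A B"
  unfolding set_sum_def by blast

lemma set_sumE:
  assumes "m \<in> set_sum A B" obtains a b where "a \<in> A" "b \<in> B" "m = a + b"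
  using assms unfolding set_sum_def by blast

lemma add_eq_add_disjoint_vars:
  assumes "a \<in> monomials X" "a' \<in> monomials X" "b \<in> monomials Y" "b' \<in> monomials Y"
    "X \<inter> Y = {}" "a + b = a' + b'"
  shows "a = a' \<and> b = b'"
proof -
  have *: "Poly_Mapping.lookup a v + Poly_Mapping.lookup b v
      = Poly_Mapping.lookup a' v + Poly_Mapping.lookup b' v" for v
    using assms(6) by (metis lookup_add)
  have "Poly_Mapping.lookup a v = Poly_Mapping.lookup a' v" for v
    using *[of v] assms(1-5) unfolding monomials_iff
    by (metis Int_iff add_0 add.right_neutral empty_iff)
  then have "a = a'" by (simp add: poly_mapping_eqI)
  then show ?thesis using assms(6) by simp
qed

lemma cone_add:
  "set_sum (cone a Z) (cone b W) = cone (a + b) (Z \<union> W)"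
proof (intro equalityI subsetI)
  fix m assume "m \<in> set_sum (cone a Z) (cone b W)"
  then show "m \<in> cone (a + b) (Z \<union> W)"
    by (auto simp: set_sum_def cone_iff lookup_add add_mono)
next
  fix m assume "m \<in> cone (a + b) (Z \<union> W)"
  then obtain c where c: "m = a + b + c" "c \<in> monomials (Z \<union> W)" by (auto simp: cone_def)
  \<comment> \<open>\<open>Z\<close> and \<open>W\<close> may overlap here; a common direction is
    charged entirely to \<open>Z\<close>.\<close>
  have "m = (a + restrict_exp Z c) + (b + restrict_exp (- Z) c)"
    unfolding c(1) by (rule poly_mapping_eqI) (auto simp: lookup_add lookup_restrict_exp when_def)
  moreover have "restrict_exp Z c \<in> monomials Z" "restrict_exp (- Z) c \<in> monomials W"
    using c(2) by (auto simp: monomials_iff lookup_restrict_exp when_def)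
  ultimately show "m \<in> set_sum (cone a Z) (cone b W)" unfolding set_sum_def cone_def by blast
qed

text \<open>Exponent form of a tensor product over the field: a cone in \<open>X\<close> plus a cone
  in \<open>Y\<close> is a cone whose dimension is the sum, and elements split uniquely because the
  variables are disjoint.\<close>

lemma stanley_depth_ge_set_sum:
  assumes A: "stanley_depth_ge X A d" "A \<subseteq> monomials X"
    and B: "stanley_depth_ge Y B e" "B \<subseteq> monomials Y"
    and XY: "X \<inter> Y = {}" and fin: "finite X" "finite Y"
  shows "stanley_depth_ge (X \<union> Y) (set_sum A B) (d + e)"
proof -
  obtain D where D: "stanley_partition X A D" "\<forall>(a, Z) \<in> D. d \<le> card Z"
    using A(1) unfolding stanley_depth_ge_def by blast
  obtain E where E: "stanley_partition Y B E" "\<forall>(a, Z) \<in> E. e \<le> card Z"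
    using B(1) unfolding stanley_depth_ge_def by blast
  let ?f = "\<lambda>((a, Z), (b, W)). (a + b, Z \<union> W)"
  have ZX: "Z \<subseteq> X" "cone a Z \<subseteq> A" if "(a, Z) \<in> D" for a Z
    using stanley_partitionD(2)[OF D(1) that] stanley_partition_cone_subset[OF D(1) that] by auto
  have WY: "W \<subseteq> Y" "cone b W \<subseteq> B" if "(b, W) \<in> E" for b W
    using stanley_partitionD(2)[OF E(1) that] stanley_partition_cone_subset[OF E(1) that] by auto
  have "stanley_partition (X \<union> Y) (set_sum A B) (?f ` (D \<times> E))"
  proof (rule stanley_partitionI)
    show "finite (?f ` (D \<times> E))"
      using stanley_partitionD(1)[OF D(1)] stanley_partitionD(1)[OF E(1)] by simp
    show "Z \<subseteq> X \<union> Y" if "(a, Z) \<in> ?f ` (D \<times> E)" for a Z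
      using that ZX(1) WY(1) by fastforce
  next
    fix m p P q Q
    assume p: "(p, P) \<in> ?f ` (D \<times> E)" and q: "(q, Q) \<in> ?f ` (D \<times> E)"
      and m: "m \<in> cone p P" "m \<in> cone q Q"
    obtain a Z b W where P: "(a, Z) \<in> D" "(b, W) \<in> E" "p = a + b" "P = Z \<union> W" using p by auto
    obtain a' Z' b' W' where Q: "(a', Z') \<in> D" "(b', W') \<in> E" "q = a' + b'" "Q = Z' \<union> W'"
      using q by auto
    have "m \<in> set_sum (cone a Z) (cone b W)" "m \<in> set_sum (cone a' Z') (cone b' W')"
      using m P Q by (auto simp: cone_add)
    then obtain s t s' t' where st: "s \<in> cone a Z" "t \<in> cone b W" "s' \<in> cone a' Z'" "t' \<in> cone b' W'"
      "s + t = s' + t'" unfolding set_sum_def by auto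
    have "s \<in> monomials X" "s' \<in> monomials X" "t \<in> monomials Y" "t' \<in> monomials Y"
      using st A(2) B(2) ZX(2)[OF P(1)] ZX(2)[OF Q(1)] WY(2)[OF P(2)] WY(2)[OF Q(2)] by auto
    then have "s = s'" "t = t'"
      using add_eq_add_disjoint_vars[OF _ _ _ _ XY st(5)] by auto
    then show "p = q \<and> P = Q"
      using stanley_partitionD(4)[OF D(1) P(1) Q(1) st(1)] stanley_partitionD(4)[OF E(1) P(2) Q(2) st(2)]
        st P Q by auto
  next
    have "set_sum A B = (\<Union>(a, Z)\<in>D. \<Union>(b, W)\<in>E. set_sum (cone a Z) (cone b W))"
      unfolding stanley_partitionD(3)[OF D(1)] stanley_partitionD(3)[OF E(1)] set_sum_def
      by fast
    also have "\<dots> = (\<Union>(a, Z) \<in> ?f ` (D \<times> E). cone a Z)"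
      unfolding cone_add by fast
    finally show "set_sum A B = (\<Union>(a, Z) \<in> ?f ` (D \<times> E). cone a Z)" .
  qed
  moreover have "\<forall>(a, Z) \<in> ?f ` (D \<times> E). d + e \<le> card Z"
  proof -
    have "d + e \<le> card (Z \<union> W)" if "(a, Z) \<in> D" "(b, W) \<in> E" for a Z b W
    proof -
      have "Z \<inter> W = {}" "finite Z" "finite W"
        using ZX(1)[OF that(1)] WY(1)[OF that(2)] XY fin by (auto intro: finite_subset)
      moreover have "d \<le> card Z" "e \<le> card W" using D(2) E(2) that by auto
      ultimately show ?thesis by (simp add: card_Un_disjoint)
    qed
    then show ?thesis by auto
  qed
  ultimately show ?thesis unfolding stanley_depth_ge_def by blast
qed

text \<open>Each class contained in \<open>A\<close> is itself a cone, with the capped exponent as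
  apex and the variables that reach \<open>g\<close> as directions.\<close>

lemma stanley_depth_ge_0:
  assumes X: "finite X" and A: "A \<subseteq> monomials X" and inv: "trunc_invariant g A"
  shows "stanley_depth_ge X A 0"
proof -
  let ?f = "\<lambda>a. (trunc_exp g a, {v \<in> X. g \<le> Poly_Mapping.lookup a v})"
  have tr: "trunc_exp g m = trunc_exp g a"
    if "m \<in> cone (trunc_exp g a) {v \<in> X. g \<le> Poly_Mapping.lookup a v}" for m a
    unfolding trunc_exp_eq_iff
  proof
    fix v
    show "min g (Poly_Mapping.lookup m v) = min g (Poly_Mapping.lookup a v)"
      using that[unfolded cone_iff lookup_trunc_exp]
      by (cases "v \<in> X \<and> g \<le> Poly_Mapping.lookup a v") (auto simp: min_def split: if_splits)
  qed
  have fi: "?f a = ?f b" if "trunc_exp g a = trunc_exp g b" for a b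
  proof -
    have "g \<le> Poly_Mapping.lookup a v \<longleftrightarrow> g \<le> Poly_Mapping.lookup b v" for v
      using that[unfolded trunc_exp_eq_iff, rule_format, of v] by linarith
    then show ?thesis using that by simp
  qed
  have "stanley_partition X A (?f ` A)"
  proof (rule stanley_partitionI)
    show "finite (?f ` A)"
      by (rule finite_subset[of _ "trunc_exp g ` A \<times> Pow X"])
        (use X finite_trunc_exp_image[OF X A] in auto)
    show "p = q \<and> P = Q"
      if pq: "(p, P) \<in> ?f ` A" "(q, Q) \<in> ?f ` A" "m \<in> cone p P" "m \<in> cone q Q" for m p P q Q
    proof -
      obtain a b where ab: "(p, P) = ?f a" "(q, Q) = ?f b" using pq(1,2) by blast
      then have "trunc_exp g m = trunc_exp g a" "trunc_exp g m = trunc_exp g b"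
        using tr[of m a] tr[of m b] pq(3,4) by simp_all
      then have "?f a = ?f b" by (intro fi) simp
      then have "(p, P) = (q, Q)" using ab by metis
      then show ?thesis by simp
    qed
    show "A = (\<Union>(a, Z) \<in> ?f ` A. cone a Z)"
    proof (intro equalityI subsetI)
      fix a assume a: "a \<in> A"
      have "a \<in> cone (trunc_exp g a) {v \<in> X. g \<le> Poly_Mapping.lookup a v}"
        unfolding cone_iff lookup_trunc_exp
      proof (intro conjI allI impI)
        fix v assume "v \<notin> {v \<in> X. g \<le> Poly_Mapping.lookup a v}"
        moreover have "v \<notin> X \<Longrightarrow> Poly_Mapping.lookup a v = 0" using A a by (auto simp: monomials_iff)
        ultimately show "Poly_Mapping.lookup a v = min g (Poly_Mapping.lookup a v)" by force
      qed simp
      then show "a \<in> (\<Union>(a, Z) \<in> ?f ` A. cone a Z)" using a by blast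
    next
      fix m assume "m \<in> (\<Union>(a, Z) \<in> ?f ` A. cone a Z)"
      then obtain a where "a \<in> A" "m \<in> cone (trunc_exp g a) {v \<in> X. g \<le> Poly_Mapping.lookup a v}"
        by blast
      then show "m \<in> A" using tr[of m a] trunc_invariantD[OF inv, of m a] by blast
    qed
    show "Z \<subseteq> X" if "(a, Z) \<in> ?f ` A" for a Z using that by blast
  qed
  moreover have "\<forall>(a, Z) \<in> ?f ` A. 0 \<le> card Z" by blast
  ultimately show ?thesis unfolding stanley_depth_ge_def by blast
qed

section \<open>Exponent sets of positive Stanley depth\<close>

lemma monomials_trunc_cong:
  assumes "0 < g" "trunc_exp g a = trunc_exp g b" "a \<in> monomials X"
  shows "b \<in> monomials X"
  unfolding monomials_iff
proof (intro allI impI)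
  fix v assume "v \<notin> X"
  then have "Poly_Mapping.lookup a v = 0" using assms(3) by (simp add: monomials_iff)
  then show "Poly_Mapping.lookup b v = 0"
    using assms(1) spec[OF assms(2)[unfolded trunc_exp_eq_iff], of v] by (simp add: min_def split: if_splits)
qed

lemma cone_single: "m \<in> cone (Poly_Mapping.single v t) {v} \<longleftrightarrow> (\<exists>j. m = Poly_Mapping.single v (t + j))"
proof
  assume "m \<in> cone (Poly_Mapping.single v t) {v}"
  then have m: "t \<le> Poly_Mapping.lookup m v" "w \<noteq> v \<Longrightarrow> Poly_Mapping.lookup m w = 0" for w
    unfolding cone_iff by (metis lookup_single_eq, metis lookup_single_not_eq singletonD)
  have "m = Poly_Mapping.single v (t + (Poly_Mapping.lookup m v - t))"
    by (rule poly_mapping_eqI) (auto simp: lookup_single when_def m)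
  then show "\<exists>j. m = Poly_Mapping.single v (t + j)" by blast
qed (auto simp: cone_iff lookup_single when_def)

text \<open>\<open>A\<close> is a union of full rays in direction \<open>v\<close>. Grouping them by
  their starting height \<open>t\<close> makes each group a product of base points in the other
  variables, of depth at least 0, and one ray, which contributes the 1.\<close>

lemma stanley_depth_ge_1_direction:
  assumes X: "finite X" and A: "A \<subseteq> monomials X" and g: "0 < g" "trunc_invariant g A"
    and v: "v \<in> X" and closed: "\<And>a. a \<in> A \<Longrightarrow> a + unit_vec v \<in> A"
  shows "stanley_depth_ge X A 1"
proof -
  \<comment> \<open>For t > 0 it suffices to exclude height t - 1, since \<open>A\<close> is closed
    upwards along \<open>v\<close>. The case t = 0 is separate because t - 1 is then 0
    again.\<close>
  define T where "T t = {b \<in> monomials (X - {v}). b + Poly_Mapping.single v t \<in> A \<and>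
    (t = 0 \<or> b + Poly_Mapping.single v (t - 1) \<notin> A)}" for t
  let ?F = "\<lambda>t. set_sum (T t) (cone (Poly_Mapping.single v t) {v})"
  have up: "a + Poly_Mapping.single v j \<in> A" if "a \<in> A" for a j
  proof (induction j)
    case (Suc j)
    then show ?case using closed[OF Suc] by (simp add: add.assoc flip: single_add)
  qed (use that in simp)
  have up': "a + Poly_Mapping.single v t' \<in> A" if "a + Poly_Mapping.single v t \<in> A" "t \<le> t'" for a t t'
    using up[OF that(1), of "t' - t"] that(2) by (simp add: add.assoc flip: single_add)
  have TX: "T t \<subseteq> monomials (X - {v})" for t by (auto simp: T_def)
  have cv: "cone (Poly_Mapping.single v t) {v} \<subseteq> monomials {v}" for t
    by (auto simp: cone_single single_monomials_iff)
  have "stanley_depth_ge X (?F t) 1" for t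
  proof -
    have "trunc_invariant g (T t)"
      unfolding trunc_invariant_def
    proof (intro allI impI)
      fix a b assume ab: "trunc_exp g a = trunc_exp g b" and a: "a \<in> T t"
      have "b \<in> monomials (X - {v})" using monomials_trunc_cong[OF g(1) ab] a by (simp add: T_def)
      then show "b \<in> T t"
        using a trunc_invariantD[OF g(2) trunc_exp_add_cong[OF ab]] by (simp add: T_def)
    qed
    then have "stanley_depth_ge (X - {v}) (T t) 0"
      using stanley_depth_ge_0[OF _ TX] X by blast
    moreover have "stanley_depth_ge {v} (cone (Poly_Mapping.single v t) {v}) 1"
      using stanley_depth_ge_cone[of "{v}" "{v}"] by simp
    ultimately have "stanley_depth_ge ((X - {v}) \<union> {v}) (?F t) (0 + 1)"
      by (intro stanley_depth_ge_set_sum TX cv) (use X in auto)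
    then show ?thesis using v by (simp add: insert_absorb)
  qed
  moreover have "disjoint_family_on ?F {..g}"
  proof -
    \<comment> \<open>A ray starting at \<open>t\<close> contains height \<open>t' - 1\<close>, so
      no ray over the same base point can start at \<open>t'\<close>.\<close>
    have "\<not> t < t'" if mm: "m \<in> ?F t" "m \<in> ?F t'" for m t t'
    proof
      assume "t < t'"
      obtain b s b' s' where bs: "b \<in> T t" "s \<in> cone (Poly_Mapping.single v t) {v}"
        "b' \<in> T t'" "s' \<in> cone (Poly_Mapping.single v t') {v}" "b + s = b' + s'"
        using mm by (auto elim!: set_sumE)
      then have "b = b'"
        using add_eq_add_disjoint_vars[of b "X - {v}" b' s "{v}" s'] TX cv by blast
      then have "b + Poly_Mapping.single v (t' - 1) \<in> A"
        using up'[of b t "t' - 1"] bs(1) \<open>t < t'\<close> by (simp add: T_def)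
      then show False using bs(3) \<open>b = b'\<close> \<open>t < t'\<close> by (simp add: T_def)
    qed
    then show ?thesis unfolding disjoint_family_on_def
      by (metis disjoint_iff linorder_neqE_nat)
  qed
  ultimately have "stanley_depth_ge X (\<Union>t\<in>{..g}. ?F t) 1"
    by (intro stanley_depth_ge_UN) auto
  also have "(\<Union>t\<in>{..g}. ?F t) = A"
  proof (intro equalityI subsetI)
    fix m assume "m \<in> (\<Union>t\<in>{..g}. ?F t)"
    then obtain t b j where "b \<in> T t" "m = b + Poly_Mapping.single v (t + j)"
      by (auto elim!: set_sumE simp: cone_single)
    then show "m \<in> A" using up'[of b t "t + j"] by (simp add: T_def)
  next
    fix m assume m: "m \<in> A"
    define n where "n = Poly_Mapping.lookup m v"
    define b where "b = restrict_exp (- {v}) m"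
    have mb: "m = b + Poly_Mapping.single v n"
      by (rule poly_mapping_eqI)
        (auto simp: b_def n_def lookup_add lookup_restrict_exp lookup_single when_def)
    have bX: "b \<in> monomials (X - {v})"
      using A m by (auto simp: b_def monomials_iff lookup_restrict_exp when_def)
    \<comment> \<open>Lowering the \<open>v\<close>-coordinate to at most \<open>g\<close> keeps the
      class, so the ray through \<open>m\<close> starts at height at most \<open>g\<close>. This
      makes the number of groups finite.\<close>
    have "trunc_exp g m = trunc_exp g (b + Poly_Mapping.single v (min g n))"
      unfolding mb trunc_exp_eq_iff lookup_add by (auto simp: lookup_single when_def b_def lookup_restrict_exp)
    then have ming: "b + Poly_Mapping.single v (min g n) \<in> A"
      using m trunc_invariantD[OF g(2)] by blast
    define t where "t = (LEAST t. b + Poly_Mapping.single v t \<in> A)"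
    have t: "b + Poly_Mapping.single v t \<in> A" "t \<le> min g n"
      using LeastI[of "\<lambda>t. b + Poly_Mapping.single v t \<in> A", OF ming]
        Least_le[of "\<lambda>t. b + Poly_Mapping.single v t \<in> A", OF ming]
      by (simp_all only: t_def)
    have "t = 0 \<or> b + Poly_Mapping.single v (t - 1) \<notin> A"
    proof (rule disjCI)
      assume "\<not> b + Poly_Mapping.single v (t - 1) \<notin> A"
      then have "b + Poly_Mapping.single v (t - 1) \<in> A" by blast
      then have "(LEAST t. b + Poly_Mapping.single v t \<in> A) \<le> t - 1" by (rule Least_le)
      then have "t \<le> t - 1" by (simp only: t_def)
      then show "t = 0" by simp
    qed
    then have "b \<in> T t" using t(1) bX by (simp add: T_def)
    moreover have "m = b + Poly_Mapping.single v (t + (n - t))" using mb t(2) by simp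
    moreover have "Poly_Mapping.single v (t + (n - t)) \<in> cone (Poly_Mapping.single v t) {v}"
      unfolding cone_single by blast
    ultimately have "m \<in> ?F t" unfolding set_sum_def by blast
    then show "m \<in> (\<Union>t\<in>{..g}. ?F t)" using t(2) by auto
  qed
  finally show ?thesis .
qed

text \<open>\<open>A\<close> is split by the first direction, in a fixed order of the variables,
  whose whole ray stays inside. Moving along that direction keeps it available and, by
  \<open>convex\<close>, opens no new one, so it remains first and each part is closed in its own
  direction.\<close>

lemma stanley_depth_ge_1:
  assumes X: "finite X" and A: "A \<subseteq> monomials X" and g: "0 < g" "trunc_invariant g A"
    and convex: "\<And>a b c. a \<in> A \<Longrightarrow> a + b + c \<in> A \<Longrightarrow> a + b \<in> A"
    and ray: "\<And>a. a \<in> A \<Longrightarrow> \<exists>v\<in>X. \<forall>t. a + Poly_Mapping.single v t \<in> A"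
  shows "stanley_depth_ge X A 1"
proof -
  obtain f :: "'a \<Rightarrow> nat" where f: "inj_on f X"
    using finite_imp_inj_to_nat_seg[OF X] by blast
  define D where "D a = {v \<in> X. \<forall>t. a + Poly_Mapping.single v t \<in> A}" for a
  define S where "S v = {a \<in> A. v \<in> D a \<and> (\<forall>w \<in> D a. f v \<le> f w)}" for v
  \<comment> \<open>The available directions depend only on the class, so each part
    \<open>S v\<close> inherits the invariance of \<open>A\<close>.\<close>
  have D_cong: "D a = D b" if "trunc_exp g a = trunc_exp g b" for a b
    unfolding D_def using trunc_invariantD[OF g(2) trunc_exp_add_cong[OF that]] by simp
  have "stanley_depth_ge X (S v) 1" if v: "v \<in> X" for v
  proof (rule stanley_depth_ge_1_direction[OF X _ g(1) _ v])
    show "S v \<subseteq> monomials X" using A by (auto simp: S_def)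
    show "trunc_invariant g (S v)"
      unfolding trunc_invariant_def
    proof (intro allI impI)
      fix a b assume ab: "trunc_exp g a = trunc_exp g b" and "a \<in> S v"
      then show "b \<in> S v" using D_cong[OF ab] trunc_invariantD[OF g(2) ab] by (simp add: S_def)
    qed
    fix a assume a: "a \<in> S v"
    then have vD: "a + Poly_Mapping.single v t \<in> A" for t by (simp add: S_def D_def)
    have "a + unit_vec v + Poly_Mapping.single v t \<in> A" for t
      using vD[of "1 + t"] by (simp add: add.assoc flip: single_add)
    then have "v \<in> D (a + unit_vec v)" using v by (simp add: D_def)
    \<comment> \<open>The exponent \<open>a + Poly_Mapping.single w t\<close> lies between
      \<open>a\<close> and its translate by \<open>unit_vec v\<close>, both in
      \<open>A\<close>.\<close>
    moreover have "D (a + unit_vec v) \<subseteq> D a"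
    proof
      fix w assume w: "w \<in> D (a + unit_vec v)"
      have "a + Poly_Mapping.single w t \<in> A" for t
      proof (rule convex)
        show "a \<in> A" using a by (simp add: S_def)
        have "a + unit_vec v + Poly_Mapping.single w t \<in> A" using w by (simp add: D_def)
        then show "a + Poly_Mapping.single w t + unit_vec v \<in> A" by (simp add: ac_simps)
      qed
      then show "w \<in> D a" using w by (simp add: D_def)
    qed
    ultimately show "a + unit_vec v \<in> S v" using a vD[of 1] by (auto simp: S_def)
  qed
  moreover have "disjoint_family_on S X"
    unfolding disjoint_family_on_def
  proof (intro ballI impI equals0I)
    fix v w a assume "v \<in> X" "w \<in> X" "v \<noteq> w" "a \<in> S v \<inter> S w"
    moreover from this have "f v = f w" by (auto simp: S_def intro: order.antisym)
    ultimately show False using f by (auto simp: inj_on_def)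
  qed
  ultimately have "stanley_depth_ge X (\<Union>v\<in>X. S v) 1"
    using X by (intro stanley_depth_ge_UN) auto
  also have "(\<Union>v\<in>X. S v) = A"
  proof (intro equalityI subsetI)
    fix a assume a: "a \<in> A"
    then have "D a \<noteq> {}" using ray by (auto simp: D_def)
    moreover have "finite (D a)" using X by (simp add: D_def)
    ultimately obtain v where "v \<in> D a" "\<And>w. w \<in> D a \<Longrightarrow> f v \<le> f w"
      by (metis arg_min_if_finite(1) arg_min_least)
    then show "a \<in> (\<Union>v\<in>X. S v)" using a by (auto simp: S_def D_def)
  qed (auto simp: S_def)
  finally show ?thesis .
qed

section \<open>Powers of edge ideals and their layers\<close>

text \<open>Exponents of the monomials in the \<open>k\<close>-th power of an edge ideal. Edges are
  ordered pairs, so that \<open>arcs_ends\<close> of a digraph can be inserted directly.\<close>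

primrec edge_pow :: "'v set \<Rightarrow> ('v \<times> 'v) set \<Rightarrow> nat \<Rightarrow> ('v \<Rightarrow>\<^sub>0 nat) set" where
  "edge_pow X R 0 = monomials X"
| "edge_pow X R (Suc k) = {a + unit_vec u + unit_vec v | a u v. a \<in> edge_pow X R k \<and> (u, v) \<in> R}"

text \<open>The exponents of the monomial basis of I^k / I^(k+1).\<close>

definition edge_layer :: "'v set \<Rightarrow> ('v \<times> 'v) set \<Rightarrow> nat \<Rightarrow> ('v \<Rightarrow>\<^sub>0 nat) set" where
  "edge_layer X R k = edge_pow X R k - edge_pow X R (Suc k)"

lemma edge_pow_SucI:
  "a \<in> edge_pow X R k \<Longrightarrow> (u, v) \<in> R \<Longrightarrow> a + unit_vec u + unit_vec v \<in> edge_pow X R (Suc k)"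
  by auto

lemma edge_pow_SucE:
  assumes "m \<in> edge_pow X R (Suc k)"
  obtains a u v where "a \<in> edge_pow X R k" "(u, v) \<in> R" "m = a + unit_vec u + unit_vec v"
  using assms by auto

declare edge_pow.simps(2) [simp del]

lemma edge_pow_subset_monomials: "R \<subseteq> X \<times> X \<Longrightarrow> edge_pow X R k \<subseteq> monomials X"
proof (induction k)
  case (Suc k)
  show ?case
  proof
    fix m assume "m \<in> edge_pow X R (Suc k)"
    then obtain a u v where "a \<in> edge_pow X R k" "(u, v) \<in> R" "m = a + unit_vec u + unit_vec v"
      by (rule edge_pow_SucE)
    then show "m \<in> monomials X"
      using Suc by (auto simp: monomials_add_iff single_monomials_iff)
  qed
qed simp

lemma edge_pow_add_monomial:
  "a \<in> edge_pow X R k \<Longrightarrow> b \<in> monomials X \<Longrightarrow> a + b \<in> edge_pow X R k"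
proof (induction k arbitrary: a)
  case (Suc k)
  from Suc.prems(1) obtain c u v where c: "c \<in> edge_pow X R k" "(u, v) \<in> R"
    "a = c + unit_vec u + unit_vec v" by (rule edge_pow_SucE)
  have "a + b = (c + b) + unit_vec u + unit_vec v" unfolding c(3) by (simp add: ac_simps)
  then show ?case using edge_pow_SucI[OF Suc.IH[OF c(1) Suc.prems(2)] c(2)] by metis
qed (simp add: monomials_add_iff)

lemma edge_pow_add:
  assumes "R \<subseteq> X \<times> X"
  shows "a \<in> edge_pow X R i \<Longrightarrow> b \<in> edge_pow X R j \<Longrightarrow> a + b \<in> edge_pow X R (i + j)"
proof (induction j arbitrary: b)
  case 0
  then show ?case by (simp add: edge_pow_add_monomial)
next
  case (Suc j)
  from Suc.prems(2) obtain c u v where c: "c \<in> edge_pow X R j" "(u, v) \<in> R"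
    "b = c + unit_vec u + unit_vec v" by (rule edge_pow_SucE)
  have "a + b = (a + c) + unit_vec u + unit_vec v" unfolding c(3) by (simp add: ac_simps)
  then show ?case using edge_pow_SucI[OF Suc.IH[OF Suc.prems(1) c(1)] c(2)] by (metis add_Suc_right)
qed

lemma edge_pow_Suc_subset:
  assumes "R \<subseteq> X \<times> X" shows "edge_pow X R (Suc k) \<subseteq> edge_pow X R k"
proof
  fix m assume "m \<in> edge_pow X R (Suc k)"
  then obtain a u v where "a \<in> edge_pow X R k" "(u, v) \<in> R" "m = a + unit_vec u + unit_vec v"
    by (rule edge_pow_SucE)
  then show "m \<in> edge_pow X R k"
    using assms by (auto intro!: edge_pow_add_monomial simp: single_monomials_iff)
qed

lemma edge_pow_antimono:
  assumes "R \<subseteq> X \<times> X" "i \<le> j" shows "edge_pow X R j \<subseteq> edge_pow X R i"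
  using lift_Suc_antimono_le[of "edge_pow X R", OF edge_pow_Suc_subset[OF assms(1)] assms(2)] .

text \<open>One pair contributes at most 2 to a coordinate, the case u = v included, so the
  generators have exponents at most 2k and membership does not see larger coordinates. Each
  induction step lowers the cap by 2.\<close>

lemma trunc_invariant_edge_pow: "2 * k < g \<Longrightarrow> trunc_invariant g (edge_pow X R k)"
proof (induction k arbitrary: g)
  case 0
  then show ?case using monomials_trunc_cong[of g] unfolding trunc_invariant_def by simp blast
next
  case (Suc k)
  show ?case
    unfolding trunc_invariant_def
  proof (intro allI impI)
    fix m b assume mb: "trunc_exp g m = trunc_exp g b" and "m \<in> edge_pow X R (Suc k)"
    then obtain a u v where a: "a \<in> edge_pow X R k" "(u, v) \<in> R"
      and m: "m = a + (unit_vec u + unit_vec v)" by (auto simp: add.assoc elim!: edge_pow_SucE)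
    define e where "e = unit_vec u + unit_vec v"
    have *: "Poly_Mapping.lookup e w \<le> 2"
      "min g (Poly_Mapping.lookup a w + Poly_Mapping.lookup e w) = min g (Poly_Mapping.lookup b w)" for w
      using spec[OF mb[unfolded trunc_exp_eq_iff], of w]
      by (auto simp: e_def m lookup_add lookup_single when_def)
    have g3: "2 < g" using Suc.prems by simp
    \<comment> \<open>As the cap exceeds 2, the capped coordinates still show that the edge divides
      \<open>b\<close>.\<close>
    have le: "Poly_Mapping.lookup e w \<le> Poly_Mapping.lookup b w" for w
      using *[of w] g3 by (simp add: min_def split: if_splits)
    have tr: "trunc_exp (g - 2) a = trunc_exp (g - 2) (b - e)"
      unfolding trunc_exp_eq_iff lookup_minus
    proof
      fix w show "min (g - 2) (Poly_Mapping.lookup a w)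
        = min (g - 2) (Poly_Mapping.lookup b w - Poly_Mapping.lookup e w)"
        using *[of w] g3 le[of w] by (auto simp: min_def split: if_splits)
    qed
    have "trunc_invariant (g - 2) (edge_pow X R k)" using Suc.prems by (intro Suc.IH) simp
    then have "b - e \<in> edge_pow X R k" using trunc_invariantD[OF _ tr] a(1) by blast
    then have "(b - e) + unit_vec u + unit_vec v \<in> edge_pow X R (Suc k)"
      using a(2) by (rule edge_pow_SucI)
    also have "(b - e) + unit_vec u + unit_vec v = b"
    proof -
      have "(b - e) + e = b"
        using le by (intro poly_mapping_eqI) (simp add: lookup_add lookup_minus)
      then show ?thesis by (simp add: e_def add.assoc)
    qed
    finally show "b \<in> edge_pow X R (Suc k)" .
  qed
qed

lemma trunc_invariant_diff:
  assumes "trunc_invariant g A" "trunc_invariant g B"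
  shows "trunc_invariant g (A - B)"
  unfolding trunc_invariant_def
proof (intro allI impI)
  fix a b assume "trunc_exp g a = trunc_exp g b" "a \<in> A - B"
  then show "b \<in> A - B" using trunc_invariantD[OF assms(1), of a b] trunc_invariantD[OF assms(2), of a b] by blast
qed

section \<open>Binomial expansions for powers and layers of disjoint unions\<close>

lemma edge_pow_Un:
  assumes R: "R \<subseteq> X \<times> X" and Q: "Q \<subseteq> Y \<times> Y"
  shows "edge_pow (X \<union> Y) (R \<union> Q) k = (\<Union>i\<le>k. set_sum (edge_pow X R i) (edge_pow Y Q (k - i)))"
proof (induction k)
  case 0
  show ?case using cone_add[of 0 X 0 Y] by (simp add: cone_zero)
next
  case (Suc k)
  show ?case
  proof (intro equalityI subsetI)
    fix m assume "m \<in> edge_pow (X \<union> Y) (R \<union> Q) (Suc k)"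
    then obtain a u v where a: "a \<in> edge_pow (X \<union> Y) (R \<union> Q) k" "(u, v) \<in> R \<union> Q"
      "m = a + unit_vec u + unit_vec v" by (rule edge_pow_SucE)
    from a(1) obtain i where i: "i \<le> k" "a \<in> set_sum (edge_pow X R i) (edge_pow Y Q (k - i))"
      unfolding Suc by blast
    from i(2) obtain b c where bc: "b \<in> edge_pow X R i" "c \<in> edge_pow Y Q (k - i)" "a = b + c"
      by (rule set_sumE)
    show "m \<in> (\<Union>i\<le>Suc k. set_sum (edge_pow X R i) (edge_pow Y Q (Suc k - i)))"
    proof (cases "(u, v) \<in> R")
      case True
      have "m = (b + unit_vec u + unit_vec v) + c" unfolding a(3) bc(3) by (simp add: ac_simps)
      then have "m \<in> set_sum (edge_pow X R (Suc i)) (edge_pow Y Q (Suc k - Suc i))"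
        using set_sumI[OF edge_pow_SucI[OF bc(1) True] bc(2)] by simp
      then show ?thesis using i(1) by blast
    next
      case False
      then have uv: "(u, v) \<in> Q" using a(2) by blast
      have "m = b + (c + unit_vec u + unit_vec v)" unfolding a(3) bc(3) by (simp add: ac_simps)
      then have "m \<in> set_sum (edge_pow X R i) (edge_pow Y Q (Suc (k - i)))"
        using set_sumI[OF bc(1) edge_pow_SucI[OF bc(2) uv]] by simp
      then have "m \<in> set_sum (edge_pow X R i) (edge_pow Y Q (Suc k - i))"
        using i(1) by (simp only: Suc_diff_le)
      then show ?thesis using i(1) by (auto intro: le_SucI)
    qed
  next
    fix m assume "m \<in> (\<Union>i\<le>Suc k. set_sum (edge_pow X R i) (edge_pow Y Q (Suc k - i)))"
    then obtain i b c where i: "i \<le> Suc k" and bc: "b \<in> edge_pow X R i" "c \<in> edge_pow Y Q (Suc k - i)"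
      "m = b + c" by (auto elim!: set_sumE)
    show "m \<in> edge_pow (X \<union> Y) (R \<union> Q) (Suc k)"
    proof (cases i)
      case (Suc i')
      from bc(1)[unfolded Suc] obtain a u v where a: "a \<in> edge_pow X R i'" "(u, v) \<in> R"
        "b = a + unit_vec u + unit_vec v" by (rule edge_pow_SucE)
      have "a + c \<in> edge_pow (X \<union> Y) (R \<union> Q) k"
        unfolding Suc.IH using i Suc bc(2) a(1) by (auto intro!: bexI[of _ i'] set_sumI)
      moreover have "m = (a + c) + unit_vec u + unit_vec v" unfolding bc a(3) by (simp add: ac_simps)
      ultimately show ?thesis using edge_pow_SucI[of "a + c" "X \<union> Y" "R \<union> Q" k u v] a(2) by simp
    next
      case 0
      from bc(2) obtain a u v where a: "a \<in> edge_pow Y Q k" "(u, v) \<in> Q"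
        "c = a + unit_vec u + unit_vec v" unfolding 0 diff_zero by (rule edge_pow_SucE)
      have "b + a \<in> edge_pow (X \<union> Y) (R \<union> Q) k"
        unfolding Suc.IH using bc(1) a(1) 0 by (auto intro!: bexI[of _ 0] set_sumI)
      moreover have "m = (b + a) + unit_vec u + unit_vec v" unfolding bc a(3) by (simp add: ac_simps)
      ultimately show ?thesis using edge_pow_SucI[of "b + a" "X \<union> Y" "R \<union> Q" k u v] a(2) by simp
    qed
  qed
qed

lemma edge_layer_subset_monomials: "R \<subseteq> X \<times> X \<Longrightarrow> edge_layer X R k \<subseteq> monomials X"
  using edge_pow_subset_monomials[of R X k] by (auto simp: edge_layer_def)

text \<open>The index of a layer is the largest power containing its elements, their order with
  respect to the ideal.\<close>

lemma edge_layer_less: 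
  assumes "R \<subseteq> X \<times> X" "a \<in> edge_layer X R i" "a \<in> edge_pow X R j" 
  shows "j \<le> i"
  using assms edge_pow_antimono[OF assms(1), of "Suc i" j] by (force simp: edge_layer_def)

lemma edge_layer_disjoint:
  assumes "R \<subseteq> X \<times> X" "i \<noteq> j" shows "edge_layer X R i \<inter> edge_layer X R j = {}"
proof (rule equals0I)
  fix a assume "a \<in> edge_layer X R i \<inter> edge_layer X R j"
  then have "j \<le> i" "i \<le> j"
    using edge_layer_less[OF assms(1), of a i j] edge_layer_less[OF assms(1), of a j i]
    by (auto simp: edge_layer_def)
  then show False using assms(2) by simp
qed

lemma set_sum_disjoint:
  assumes "A \<subseteq> monomials X" "A' \<subseteq> monomials X" "B \<subseteq> monomials Y" "B' \<subseteq> monomials Y"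
    "X \<inter> Y = {}" "A \<inter> A' = {} \<or> B \<inter> B' = {}"
  shows "set_sum A B \<inter> set_sum A' B' = {}"
proof (rule equals0I)
  fix m assume "m \<in> set_sum A B \<inter> set_sum A' B'"
  then obtain a b a' b' where ab: "a \<in> A" "b \<in> B" "a' \<in> A'" "b' \<in> B'" "a + b = a' + b'"
    by (auto elim!: set_sumE)
  then have "a = a' \<and> b = b'"
    using assms(1-4) by (intro add_eq_add_disjoint_vars[OF _ _ _ _ assms(5)]) auto
  then show False using ab assms(6) by blast
qed

text \<open>The order is additive over disjoint variables: raising the power of either part would
  raise the power of the sum, and conversely.\<close>

lemma edge_layer_Un:
  assumes R: "R \<subseteq> X \<times> X" and Q: "Q \<subseteq> Y \<times> Y" and XY: "X \<inter> Y = {}"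
  shows "edge_layer (X \<union> Y) (R \<union> Q) k = (\<Union>i\<le>k. set_sum (edge_layer X R i) (edge_layer Y Q (k - i)))"
proof (intro equalityI subsetI)
  fix m assume m: "m \<in> edge_layer (X \<union> Y) (R \<union> Q) k"
  then have m1: "m \<in> edge_pow (X \<union> Y) (R \<union> Q) k" and m2: "m \<notin> edge_pow (X \<union> Y) (R \<union> Q) (Suc k)"
    by (simp_all add: edge_layer_def)
  obtain i a b where i: "i \<le> k" and ab: "a \<in> edge_pow X R i" "b \<in> edge_pow Y Q (k - i)" "m = a + b"
    using m1 unfolding edge_pow_Un[OF R Q] by (auto elim!: set_sumE)
  have "a \<notin> edge_pow X R (Suc i)"
  proof
    assume "a \<in> edge_pow X R (Suc i)"
    then have "m \<in> set_sum (edge_pow X R (Suc i)) (edge_pow Y Q (Suc k - Suc i))"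
      using ab by (simp add: set_sumI)
    then show False using m2 i unfolding edge_pow_Un[OF R Q] by blast
  qed
  moreover have "b \<notin> edge_pow Y Q (Suc (k - i))"
  proof
    assume "b \<in> edge_pow Y Q (Suc (k - i))"
    then have "m \<in> set_sum (edge_pow X R i) (edge_pow Y Q (Suc k - i))"
      using ab i by (simp add: set_sumI Suc_diff_le)
    then show False using m2 i unfolding edge_pow_Un[OF R Q] by (auto intro: le_SucI)
  qed
  ultimately have "m \<in> set_sum (edge_layer X R i) (edge_layer Y Q (k - i))"
    using ab by (simp add: set_sumI edge_layer_def)
  then show "m \<in> (\<Union>i\<le>k. set_sum (edge_layer X R i) (edge_layer Y Q (k - i)))" using i by blast
next
  fix m assume "m \<in> (\<Union>i\<le>k. set_sum (edge_layer X R i) (edge_layer Y Q (k - i)))"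
  then obtain i a b where i: "i \<le> k" and ab: "a \<in> edge_layer X R i" "b \<in> edge_layer Y Q (k - i)"
    "m = a + b" by (auto elim!: set_sumE)
  have "m \<in> set_sum (edge_pow X R i) (edge_pow Y Q (k - i))"
    using ab by (simp add: set_sumI edge_layer_def)
  then have "m \<in> edge_pow (X \<union> Y) (R \<union> Q) k"
    using i unfolding edge_pow_Un[OF R Q] by blast
  moreover have "m \<notin> edge_pow (X \<union> Y) (R \<union> Q) (Suc k)"
  proof
    assume "m \<in> edge_pow (X \<union> Y) (R \<union> Q) (Suc k)"
    then obtain j a' b' where j: "j \<le> Suc k"
      and ab': "a' \<in> edge_pow X R j" "b' \<in> edge_pow Y Q (Suc k - j)" "m = a' + b'"
      unfolding edge_pow_Un[OF R Q] by (auto elim!: set_sumE)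
    have "a' = a \<and> b' = b"
      using ab ab' edge_pow_subset_monomials[OF R] edge_pow_subset_monomials[OF Q]
      by (intro add_eq_add_disjoint_vars[OF _ _ _ _ XY])
        (auto simp: edge_layer_def)
    \<comment> \<open>Unique splitting forces the higher factorisation to use the same two parts,
      and maximality of both orders then bounds the total k + 1 by k.\<close>
    then have "j \<le> i" "Suc k - j \<le> k - i"
      using edge_layer_less[OF R ab(1), of j] edge_layer_less[OF Q ab(2), of "Suc k - j"] ab' by auto
    then show False using i by linarith
  qed
  ultimately show "m \<in> edge_layer (X \<union> Y) (R \<union> Q) k" by (simp add: edge_layer_def)
qed

text \<open>The summands of the binomial expansion overlap; indexing by the exact order of the part
  in \<open>Y\<close>, cut off at \<open>k\<close>, is what allows their Stanley partitions to be
  put together.\<close>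

lemma edge_pow_Un_layers:
  assumes R: "R \<subseteq> X \<times> X" and Q: "Q \<subseteq> Y \<times> Y"
  shows "edge_pow (X \<union> Y) (R \<union> Q) k =
    set_sum (monomials X) (edge_pow Y Q k) \<union>
    (\<Union>j<k. set_sum (edge_pow X R (k - j)) (edge_layer Y Q j))"
proof (intro equalityI subsetI)
  fix m assume "m \<in> edge_pow (X \<union> Y) (R \<union> Q) k"
  then obtain i a b where i: "i \<le> k" and ab: "a \<in> edge_pow X R i" "b \<in> edge_pow Y Q (k - i)" "m = a + b"
    unfolding edge_pow_Un[OF R Q] by (auto elim!: set_sumE)
  show "m \<in> set_sum (monomials X) (edge_pow Y Q k) \<union>
    (\<Union>j<k. set_sum (edge_pow X R (k - j)) (edge_layer Y Q j))"
  proof (cases "b \<in> edge_pow Y Q k")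
    case True
    then show ?thesis using ab edge_pow_subset_monomials[OF R] by (auto intro: set_sumI)
  next
    case False
    \<comment> \<open>The bound j \<le> k makes a greatest index exist. The expansion supplies k - i
      as a candidate, which later gives k - j \<le> i.\<close>
    let ?P = "\<lambda>j. b \<in> edge_pow Y Q j \<and> j \<le> k"
    define j where "j = Greatest ?P"
    have j: "?P j" "k - i \<le> j"
      using GreatestI_nat[of ?P "k - i" k] Greatest_le_nat[of ?P "k - i" k] ab(2)
      unfolding j_def by simp_all
    have "j \<noteq> k" using j(1) False by auto
    then have "j < k" using j(1) by simp
    have "b \<notin> edge_pow Y Q (Suc j)"
    proof
      assume "b \<in> edge_pow Y Q (Suc j)"
      then have "Suc j \<le> j"
        using Greatest_le_nat[of ?P "Suc j" k] \<open>j < k\<close> unfolding j_def by simp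
      then show False by simp
    qed
    then have "b \<in> edge_layer Y Q j" using j(1) by (simp add: edge_layer_def)
    moreover have "k - j \<le> i" using i j(2) by linarith
    then have "a \<in> edge_pow X R (k - j)" using ab(1) edge_pow_antimono[OF R] by blast
    ultimately show ?thesis using \<open>j < k\<close> ab(3) by (auto intro: set_sumI)
  qed
next
  fix m assume "m \<in> set_sum (monomials X) (edge_pow Y Q k) \<union>
    (\<Union>j<k. set_sum (edge_pow X R (k - j)) (edge_layer Y Q j))"
  then have "\<exists>j\<le>k. m \<in> set_sum (edge_pow X R (k - j)) (edge_pow Y Q (k - (k - j)))"
  proof
    assume "m \<in> set_sum (monomials X) (edge_pow Y Q k)"
    then show ?thesis by (intro exI[of _ k]) simp
  next
    assume "m \<in> (\<Union>j<k. set_sum (edge_pow X R (k - j)) (edge_layer Y Q j))"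
    then obtain j where "j < k" "m \<in> set_sum (edge_pow X R (k - j)) (edge_layer Y Q j)" by blast
    then show ?thesis
      by (intro exI[of _ j]) (auto elim!: set_sumE intro!: set_sumI simp: edge_layer_def)
  qed
  then show "m \<in> edge_pow (X \<union> Y) (R \<union> Q) k"
    unfolding edge_pow_Un[OF R Q] by (meson UN_I atMost_iff diff_le_self)
qed

section \<open>Bipartite graphs\<close>

definition vertex_cover :: "'v set \<Rightarrow> ('v \<times> 'v) set \<Rightarrow> 'v set \<Rightarrow> bool" where
  "vertex_cover X R C \<longleftrightarrow> C \<subseteq> X \<and> (\<forall>(u, v) \<in> R. u \<in> C \<or> v \<in> C)"

definition bipartition :: "('v \<times> 'v) set \<Rightarrow> 'v set \<Rightarrow> 'v set \<Rightarrow> bool" where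
  "bipartition R A B \<longleftrightarrow> A \<inter> B = {} \<and> R \<subseteq> A \<times> B \<union> B \<times> A"

definition weight :: "('v \<Rightarrow>\<^sub>0 nat) \<Rightarrow> 'v set \<Rightarrow> nat" where
  "weight a C = (\<Sum>v\<in>C. Poly_Mapping.lookup a v)"

lemma weight_add: "weight (a + b) C = weight a C + weight b C"
  by (simp add: weight_def lookup_add sum.distrib)

lemma weight_single: "finite C \<Longrightarrow> weight (Poly_Mapping.single v n) C = (if v \<in> C then n else 0)"
  by (simp add: weight_def lookup_single when_def)

lemma weight_Un: "finite C \<Longrightarrow> finite D \<Longrightarrow> C \<inter> D = {} \<Longrightarrow> weight a (C \<union> D) = weight a C + weight a D"
  by (simp add: weight_def sum.union_disjoint)

lemma weight_restrict_exp: "finite C \<Longrightarrow> weight (restrict_exp A a) C = weight a (C \<inter> A)"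
  by (simp add: weight_def lookup_restrict_exp when_def sum.inter_restrict)

text \<open>Weak duality: each of the \<open>k\<close> edges adds at least 1 to the weight of any
  cover. \<open>koenig\<close> is the converse for bipartite graphs.\<close>

lemma edge_pow_le_weight:
  assumes X: "finite X" and C: "vertex_cover X R C"
  shows "a \<in> edge_pow X R k \<Longrightarrow> k \<le> weight a C"
proof (induction k arbitrary: a)
  case (Suc k)
  from Suc.prems obtain b u v where b: "b \<in> edge_pow X R k" "(u, v) \<in> R"
    "a = b + unit_vec u + unit_vec v" by (rule edge_pow_SucE)
  have "finite C" "u \<in> C \<or> v \<in> C"
    using C b(2) X finite_subset[of C X] unfolding vertex_cover_def by auto
  then have "weight a C \<ge> weight b C + 1" unfolding b(3) by (auto simp: weight_add weight_single)
  then show ?case using Suc.IH[OF b(1)] by simp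
qed simp

lemma bipartition_sym: "bipartition R A B \<Longrightarrow> bipartition R B A"
  unfolding bipartition_def by blast

text \<open>Only an edge whose \<open>B\<close>-end is outside \<open>C\<close> needs thought. Its
  \<open>A\<close>-end then lies in \<open>C\<close>, so both ends lie in the region where the new
  set follows \<open>D\<close>, and \<open>D\<close> covers the edge.\<close>

lemma vertex_cover_exchange:
  assumes AB: "bipartition R A B" "A \<union> B = X"
    and C: "vertex_cover X R C" and D: "vertex_cover X R D"
  shows "vertex_cover X R (D \<inter> (C \<inter> A \<union> (B - C)) \<union> C \<inter> B)"
  unfolding vertex_cover_def
proof (intro conjI ballI)
  show "D \<inter> (C \<inter> A \<union> (B - C)) \<union> C \<inter> B \<subseteq> X" using D AB(2) by (auto simp: vertex_cover_def)
next
  fix e assume e: "e \<in> R"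
  obtain u v where uv: "e = (u, v)" by force
  have "u \<in> A \<and> v \<in> B \<or> u \<in> B \<and> v \<in> A" "u \<in> C \<or> v \<in> C" "u \<in> D \<or> v \<in> D"
    using e uv AB(1) C D by (auto simp: vertex_cover_def bipartition_def)
  then show "case e of (u, v) \<Rightarrow> u \<in> D \<inter> (C \<inter> A \<union> (B - C)) \<union> C \<inter> B \<or>
      v \<in> D \<inter> (C \<inter> A \<union> (B - C)) \<union> C \<inter> B"
    unfolding uv by auto
qed

text \<open>The exchanged cover weighs at least \<open>k\<close> and \<open>C\<close> exactly
  \<open>k\<close>; cancelling the common part \<open>C \<inter> B\<close> leaves the claim. It is
  the cover condition for a piece of \<open>a\<close>, as needed to apply induction to that
  piece.\<close>

lemma tight_cover_restrict:
  assumes X: "finite X" and AB: "bipartition R A B" "A \<union> B = X"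
    and C: "vertex_cover X R C" "weight a C = k"
    and min: "\<And>D. vertex_cover X R D \<Longrightarrow> k \<le> weight a D" and D: "vertex_cover X R D"
  shows "weight a (C \<inter> A) \<le> weight (restrict_exp (C \<inter> A \<union> (B - C)) a) D"
proof -
  have dis: "A \<inter> B = {}" using AB(1) by (simp add: bipartition_def)
  have "C \<subseteq> X" "D \<subseteq> X" using C D by (auto simp: vertex_cover_def)
  then have fin: "finite C" "finite D" using X by (auto intro: finite_subset)
  have "C = C \<inter> A \<union> C \<inter> B" using \<open>C \<subseteq> X\<close> AB(2) by blast
  then have "weight a C = weight a (C \<inter> A \<union> C \<inter> B)" by (rule arg_cong)
  also have "\<dots> = weight a (C \<inter> A) + weight a (C \<inter> B)"
    using fin dis by (intro weight_Un) auto
  finally have "weight a (C \<inter> A) + weight a (C \<inter> B) = k" using C(2) by simp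
  also have "k \<le> weight a (D \<inter> (C \<inter> A \<union> (B - C)) \<union> C \<inter> B)"
    by (intro min vertex_cover_exchange AB C(1) D)
  also have "\<dots> = weight a (D \<inter> (C \<inter> A \<union> (B - C))) + weight a (C \<inter> B)"
    using fin dis by (intro weight_Un) auto
  finally show ?thesis using fin by (simp add: weight_restrict_exp)
qed

text \<open>
  If removing an edge lowers the minimal cover weight by at most one, we induct; otherwise the
  edge lies inside a cover of minimal weight, which splits the exponent into two smaller ones.
\<close>

lemma koenig:
  assumes X: "finite X" and AB: "bipartition R A B" "A \<union> B = X" and R: "R \<subseteq> X \<times> X"
  shows "a \<in> monomials X \<Longrightarrow> (\<And>C. vertex_cover X R C \<Longrightarrow> k \<le> weight a C) \<Longrightarrow> a \<in> edge_pow X R k"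
proof (induction "weight a X" arbitrary: a k rule: less_induct)
  case less
  show ?case
  proof (cases k)
    case 0
    then show ?thesis using less.prems by simp
  next
    case (Suc k')
    \<comment> \<open>Otherwise the zero set of \<open>a\<close> would be a cover of weight 0,
      although \<open>k\<close> is positive.\<close>
    have "\<exists>(u, v) \<in> R. Poly_Mapping.lookup a u > 0 \<and> Poly_Mapping.lookup a v > 0"
    proof (rule ccontr)
      assume "\<not> ?thesis"
      then have "vertex_cover X R {v \<in> X. Poly_Mapping.lookup a v = 0}"
        using R by (auto simp: vertex_cover_def)
      from less.prems(2)[OF this] show False using Suc by (simp add: weight_def)
    qed
    then obtain u v where uv: "(u, v) \<in> R"
      and pos: "Poly_Mapping.lookup a u > 0" "Poly_Mapping.lookup a v > 0" by auto
    have uvX: "u \<in> X" "v \<in> X" using R uv by auto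
    have "u \<in> A \<and> v \<in> B \<or> u \<in> B \<and> v \<in> A" "A \<inter> B = {}" using uv AB(1) by (auto simp: bipartition_def)
    then have "u \<noteq> v" by blast
    define b where "b = a - (unit_vec u + unit_vec v)"
    have ab: "a = b + unit_vec u + unit_vec v"
      using pos \<open>u \<noteq> v\<close>
      by (intro poly_mapping_eqI) (auto simp: b_def lookup_add lookup_minus lookup_single when_def)
    have bX: "b \<in> monomials X" using less.prems(1) unfolding ab monomials_add_iff by blast
    show ?thesis
    proof (cases "\<forall>C. vertex_cover X R C \<longrightarrow> k' \<le> weight b C")
      case True
      have "weight b X < weight a X" unfolding ab using X uvX by (simp add: weight_add weight_single)
      then have "b \<in> edge_pow X R k'" using less.hyps[OF _ bX] True by blast
      then show ?thesis unfolding Suc ab using uv by (rule edge_pow_SucI)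
    next
      case False
      then obtain C where C: "vertex_cover X R C" "weight b C < k'" by auto
      have CX: "C \<subseteq> X" using C(1) by (simp add: vertex_cover_def)
      then have fC: "finite C" using X finite_subset by blast
      have "weight a C = weight b C + (if u \<in> C then 1 else 0) + (if v \<in> C then 1 else 0)"
        unfolding ab using fC by (simp add: weight_add weight_single)
      \<comment> \<open>Putting the edge back raises the weight of \<open>C\<close> by at most 2,
        from below \<open>k'\<close> to at least \<open>k' + 1\<close>. So the rise is exactly 2,
        and both ends lie in \<open>C\<close>.\<close>
      then have wC: "weight a C = k" and uvC: "u \<in> C" "v \<in> C"
        using less.prems(2)[OF C(1)] C(2) Suc by (auto split: if_splits)
      \<comment> \<open>The orientation of the bipartition is left open because both sides are
        needed. The restriction cuts off the vertex \<open>t\<close> of positive exponent, so the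
        total weight drops and the induction hypothesis applies.\<close>
      have part: "restrict_exp (C \<inter> A' \<union> (B' - C)) a \<in> edge_pow X R (weight a (C \<inter> A'))"
        if AB': "bipartition R A' B'" "A' \<union> B' = X" and t: "t \<in> C \<inter> B'" "Poly_Mapping.lookup a t > 0"
        for A' B' t
      proof (rule less.hyps)
        have "t \<notin> A'" using AB'(1) t(1) by (auto simp: bipartition_def)
        then have "t \<notin> C \<inter> A' \<union> (B' - C)" "t \<in> X" using t(1) CX by auto
        then have "X \<inter> (C \<inter> A' \<union> (B' - C)) \<subseteq> X - {t}" by blast
        then have "weight (restrict_exp (C \<inter> A' \<union> (B' - C)) a) X \<le> weight a (X - {t})"
          unfolding weight_restrict_exp[OF X] unfolding weight_def by (intro sum_mono2) (use X in auto)
        also have "\<dots> < weight a X"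
          using X \<open>t \<in> X\<close> t(2) by (simp add: weight_def sum.remove[of X t])
        finally show "weight (restrict_exp (C \<inter> A' \<union> (B' - C)) a) X < weight a X" .
        show "restrict_exp (C \<inter> A' \<union> (B' - C)) a \<in> monomials X"
          using less.prems(1) by (simp add: monomials_iff lookup_restrict_exp)
        show "weight a (C \<inter> A') \<le> weight (restrict_exp (C \<inter> A' \<union> (B' - C)) a) D"
          if "vertex_cover X R D" for D
          using tight_cover_restrict[OF X AB' C(1) wC less.prems(2) that] .
      qed
      obtain s t where "s \<in> C \<inter> A" "t \<in> C \<inter> B" "Poly_Mapping.lookup a s > 0" "Poly_Mapping.lookup a t > 0"
        using uvC pos \<open>u \<in> A \<and> v \<in> B \<or> u \<in> B \<and> v \<in> A\<close> by blast
      then have "restrict_exp (C \<inter> A \<union> (B - C)) a \<in> edge_pow X R (weight a (C \<inter> A))"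
        "restrict_exp (C \<inter> B \<union> (A - C)) a \<in> edge_pow X R (weight a (C \<inter> B))"
        using part[OF AB, of t] part[OF bipartition_sym[OF AB(1)], of s] AB(2) by (auto simp: Un_commute)
      then have "restrict_exp (C \<inter> A \<union> (B - C)) a + restrict_exp (C \<inter> B \<union> (A - C)) a
          \<in> edge_pow X R (weight a (C \<inter> A) + weight a (C \<inter> B))"
        by (rule edge_pow_add[OF R])
      \<comment> \<open>The two supports \<open>C \<inter> A \<union> (B - C)\<close> and
        \<open>C \<inter> B \<union> (A - C)\<close> partition \<open>X\<close>.\<close>
      also have "restrict_exp (C \<inter> A \<union> (B - C)) a + restrict_exp (C \<inter> B \<union> (A - C)) a = a"
      proof (rule poly_mapping_eqI)
        fix x
        have "x \<in> X \<or> Poly_Mapping.lookup a x = 0" using less.prems(1) by (auto simp: monomials_iff)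
        then show "Poly_Mapping.lookup (restrict_exp (C \<inter> A \<union> (B - C)) a
            + restrict_exp (C \<inter> B \<union> (A - C)) a) x = Poly_Mapping.lookup a x"
          using AB(2) \<open>A \<inter> B = {}\<close> by (auto simp: lookup_add lookup_restrict_exp when_def)
      qed
      also have "weight a (C \<inter> A) + weight a (C \<inter> B) = k"
      proof -
        have "weight a (C \<inter> A \<union> C \<inter> B) = weight a (C \<inter> A) + weight a (C \<inter> B)"
          using fC \<open>A \<inter> B = {}\<close> by (intro weight_Un) auto
        moreover have "C \<inter> A \<union> C \<inter> B = C" using CX AB(2) by blast
        ultimately show ?thesis using wC by simp
      qed
      finally show ?thesis .
    qed
  qed
qed

lemma bipartite_layer_ray:
  assumes X: "finite X" "X \<noteq> {}" and AB: "bipartition R A B" "A \<union> B = X" and R: "R \<subseteq> X \<times> X"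
    and a: "a \<in> edge_layer X R k"
  shows "\<exists>v\<in>X. \<forall>t. a + Poly_Mapping.single v t \<in> edge_layer X R k"
proof -
  have aX: "a \<in> monomials X" using a edge_layer_subset_monomials[OF R] by blast
  have "\<exists>C. vertex_cover X R C \<and> weight a C \<le> k"
    using koenig[OF X(1) AB R aX, of "Suc k"] a by (force simp: edge_layer_def)
  then obtain C where C: "vertex_cover X R C" "weight a C \<le> k" by blast
  \<comment> \<open>A variable outside the cover has to exist. If the cover is all of
    \<open>X\<close>, one side of the bipartition replaces it; if that side is \<open>X\<close> as
    well, there are no edges and the empty set is a cover.\<close>
  have "\<exists>C'. vertex_cover X R C' \<and> weight a C' \<le> k \<and> C' \<noteq> X"
  proof (cases "C = X")
    case True
    show ?thesis
    proof (cases "A = X")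
      case True
      then have "B = {}" using AB unfolding bipartition_def by blast
      then have "vertex_cover X R {}" using AB by (simp add: vertex_cover_def bipartition_def)
      then show ?thesis using X(2) by (intro exI[of _ "{}"]) (simp add: weight_def)
    next
      case False
      have "vertex_cover X R A" using AB by (auto simp: vertex_cover_def bipartition_def)
      moreover have "weight a A \<le> weight a X"
        using AB(2) X(1) unfolding weight_def by (intro sum_mono2) auto
      ultimately show ?thesis using False C(2) True by (intro exI[of _ A]) simp
    qed
  qed (use C in blast)
  then obtain C' where C': "vertex_cover X R C'" "weight a C' \<le> k" "C' \<noteq> X" by blast
  then have "C' \<subseteq> X" by (simp add: vertex_cover_def)
  then obtain v where v: "v \<in> X" "v \<notin> C'" using C'(3) by blast
  have "finite C'" using \<open>C' \<subseteq> X\<close> X(1) finite_subset by blast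
  have "a + Poly_Mapping.single v t \<in> edge_layer X R k" for t
  proof -
    have "weight (a + Poly_Mapping.single v t) C' \<le> k"
      using v C'(2) \<open>finite C'\<close> by (simp add: weight_add weight_single)
    then have "a + Poly_Mapping.single v t \<notin> edge_pow X R (Suc k)"
      using edge_pow_le_weight[OF X(1) C'(1)] by fastforce
    moreover have "a + Poly_Mapping.single v t \<in> edge_pow X R k"
      using a v(1) by (intro edge_pow_add_monomial) (auto simp: edge_layer_def single_monomials_iff)
    ultimately show ?thesis by (simp add: edge_layer_def)
  qed
  then show ?thesis using v(1) by blast
qed

text \<open>The power k + 1 removed from the layer asks for a cap above 2(k + 1); the first such
  value is 2k + 3.\<close>

lemma trunc_invariant_edge_layer: "trunc_invariant (2 * k + 3) (edge_layer X R k)"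
  unfolding edge_layer_def by (intro trunc_invariant_diff trunc_invariant_edge_pow) auto

lemma stanley_depth_ge_layer_0:
  "finite X \<Longrightarrow> R \<subseteq> X \<times> X \<Longrightarrow> stanley_depth_ge X (edge_layer X R k) 0"
  by (rule stanley_depth_ge_0[OF _ edge_layer_subset_monomials trunc_invariant_edge_layer])

text \<open>A difference of two sets closed under multiplication by monomials contains everything
  between two of its elements.\<close>

lemma edge_layer_convex:
  assumes "R \<subseteq> X \<times> X" "a \<in> edge_layer X R k" "a + b + c \<in> edge_layer X R k"
  shows "a + b \<in> edge_layer X R k"
proof -
  have "a + b + c \<in> monomials X" using assms edge_layer_subset_monomials by blast
  then have "b \<in> monomials X" "c \<in> monomials X" by (simp_all add: monomials_add_iff)
  then show ?thesis
    using assms(2,3) edge_pow_add_monomial[of a X R k b] edge_pow_add_monomial[of "a + b" X R "Suc k" c]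
    by (auto simp: edge_layer_def)
qed

lemma stanley_depth_ge_bipartite_layer:
  assumes X: "finite X" "X \<noteq> {}" and AB: "bipartition R A B" "A \<union> B = X" and R: "R \<subseteq> X \<times> X"
  shows "stanley_depth_ge X (edge_layer X R k) 1"
  using X(1) edge_layer_subset_monomials[OF R] _ trunc_invariant_edge_layer
    edge_layer_convex[OF R] bipartite_layer_ray[OF X AB R]
  by (rule stanley_depth_ge_1) auto

text \<open>An upward closed set contains the ray in every direction, so the bound 1 holds for every
  component, bipartite or not. For \<open>H\<close> the lemma also provides the existence of a
  finite decomposition.\<close>

lemma stanley_depth_ge_edge_pow:
  assumes X: "finite X" "X \<noteq> {}" and R: "R \<subseteq> X \<times> X"
  shows "stanley_depth_ge X (edge_pow X R k) 1"
proof (rule stanley_depth_ge_1[OF X(1) edge_pow_subset_monomials[OF R]])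
  show "trunc_invariant (2 * k + 1) (edge_pow X R k)" by (rule trunc_invariant_edge_pow) simp
  fix a b c :: "'a \<Rightarrow>\<^sub>0 nat"
  assume "a \<in> edge_pow X R k" "a + b + c \<in> edge_pow X R k"
  then have "a + b + c \<in> monomials X" using edge_pow_subset_monomials[OF R] by blast
  then have "b \<in> monomials X" by (simp add: monomials_add_iff)
  then show "a + b \<in> edge_pow X R k" using \<open>a \<in> edge_pow X R k\<close> by (intro edge_pow_add_monomial)
next
  fix a assume "a \<in> edge_pow X R k"
  moreover obtain v where "v \<in> X" using X(2) by blast
  ultimately show "\<exists>v\<in>X. \<forall>t. a + Poly_Mapping.single v t \<in> edge_pow X R k"
    by (auto intro!: bexI[of _ v] edge_pow_add_monomial simp: single_monomials_iff)
qed simp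

section \<open>Disjoint unions of graphs\<close>

text \<open>Serves both to split \<open>H\<close> off the graph and to peel components off the rest.
  The bound \<open>d \<le> card X\<close> handles the summand whose part in \<open>X\<close> is
  unrestricted.\<close>

lemma stanley_depth_ge_edge_pow_Un:
  assumes fin: "finite X" "finite Y" and XY: "X \<inter> Y = {}"
    and R: "R \<subseteq> X \<times> X" and Q: "Q \<subseteq> Y \<times> Y"
    and X: "\<And>l. 1 \<le> l \<Longrightarrow> l \<le> k \<Longrightarrow> stanley_depth_ge X (edge_pow X R l) d" "d \<le> card X"
    and Y: "\<And>j. j < k \<Longrightarrow> stanley_depth_ge Y (edge_layer Y Q j) e" "stanley_depth_ge Y (edge_pow Y Q k) e"
  shows "stanley_depth_ge (X \<union> Y) (edge_pow (X \<union> Y) (R \<union> Q) k) (d + e)"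
  unfolding edge_pow_Un_layers[OF R Q]
proof (rule stanley_depth_ge_Un)
  have X0: "stanley_depth_ge X (monomials X) d"
    using stanley_depth_ge_monomials X(2) by (rule stanley_depth_ge_mono)
  show "stanley_depth_ge (X \<union> Y) (set_sum (monomials X) (edge_pow Y Q k)) (d + e)"
    by (intro stanley_depth_ge_set_sum X0 Y(2) XY fin edge_pow_subset_monomials[OF Q] order_refl)
  show "stanley_depth_ge (X \<union> Y) (\<Union>j<k. set_sum (edge_pow X R (k - j)) (edge_layer Y Q j)) (d + e)"
  proof (rule stanley_depth_ge_UN)
    show "disjoint_family_on (\<lambda>j. set_sum (edge_pow X R (k - j)) (edge_layer Y Q j)) {..<k}"
      unfolding disjoint_family_on_def
    proof (intro ballI impI)
      fix i j :: nat assume "i \<noteq> j"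
      then have "edge_layer Y Q i \<inter> edge_layer Y Q j = {}" by (rule edge_layer_disjoint[OF Q])
      then show "set_sum (edge_pow X R (k - i)) (edge_layer Y Q i) \<inter>
          set_sum (edge_pow X R (k - j)) (edge_layer Y Q j) = {}"
        by (intro set_sum_disjoint[of _ X _ _ Y] disjI2 XY
            edge_pow_subset_monomials[OF R] edge_layer_subset_monomials[OF Q])
    qed
    show "stanley_depth_ge (X \<union> Y) (set_sum (edge_pow X R (k - j)) (edge_layer Y Q j)) (d + e)"
      if "j \<in> {..<k}" for j
      using that by (intro stanley_depth_ge_set_sum X(1) Y(1) XY fin
          edge_pow_subset_monomials[OF R] edge_layer_subset_monomials[OF Q]) auto
  qed simp
  have "set_sum (monomials X) (edge_pow Y Q k) \<inter> set_sum (edge_pow X R (k - j)) (edge_layer Y Q j) = {}"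
    if "j < k" for j
  proof (rule set_sum_disjoint[OF order_refl edge_pow_subset_monomials[OF R]
        edge_pow_subset_monomials[OF Q] edge_layer_subset_monomials[OF Q] XY], rule disjI2)
    show "edge_pow Y Q k \<inter> edge_layer Y Q j = {}"
      using edge_layer_less[OF Q, of _ j k] that by fastforce
  qed
  then show "set_sum (monomials X) (edge_pow Y Q k) \<inter>
      (\<Union>j<k. set_sum (edge_pow X R (k - j)) (edge_layer Y Q j)) = {}" by blast
qed

lemma stanley_depth_ge_edge_layer_Un:
  assumes fin: "finite X" "finite Y" and XY: "X \<inter> Y = {}"
    and R: "R \<subseteq> X \<times> X" and Q: "Q \<subseteq> Y \<times> Y"
    and X: "\<And>j. stanley_depth_ge X (edge_layer X R j) d"
    and Y: "\<And>j. stanley_depth_ge Y (edge_layer Y Q j) e"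
  shows "stanley_depth_ge (X \<union> Y) (edge_layer (X \<union> Y) (R \<union> Q) k) (d + e)"
  unfolding edge_layer_Un[OF R Q XY]
proof (rule stanley_depth_ge_UN)
  show "disjoint_family_on (\<lambda>i. set_sum (edge_layer X R i) (edge_layer Y Q (k - i))) {..k}"
    unfolding disjoint_family_on_def
  proof (intro ballI impI)
    fix i j :: nat assume "i \<noteq> j"
    then have "edge_layer X R i \<inter> edge_layer X R j = {}" by (rule edge_layer_disjoint[OF R])
    then show "set_sum (edge_layer X R i) (edge_layer Y Q (k - i)) \<inter>
        set_sum (edge_layer X R j) (edge_layer Y Q (k - j)) = {}"
      by (intro set_sum_disjoint[of _ X _ _ Y] disjI1 XY
          edge_layer_subset_monomials[OF R] edge_layer_subset_monomials[OF Q])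
  qed
  show "stanley_depth_ge (X \<union> Y) (set_sum (edge_layer X R i) (edge_layer Y Q (k - i))) (d + e)" for i
    by (intro stanley_depth_ge_set_sum X Y XY fin
        edge_layer_subset_monomials[OF R] edge_layer_subset_monomials[OF Q])
qed simp

text \<open>Both claims share one induction, since the step for powers uses layers and powers of the
  components already treated.\<close>

lemma stanley_depth_ge_components:
  fixes V :: "'i \<Rightarrow> 'v set" and E :: "'i \<Rightarrow> ('v \<times> 'v) set"
  defines "bip \<equiv> \<lambda>i. \<exists>A B. bipartition (E i) A B \<and> A \<union> B = V i"
  assumes "finite S" "disjoint_family_on V S"
    and "\<And>i. i \<in> S \<Longrightarrow> finite (V i) \<and> V i \<noteq> {} \<and> E i \<subseteq> V i \<times> V i"
  shows "stanley_depth_ge (\<Union>(V ` S)) (edge_layer (\<Union>(V ` S)) (\<Union>(E ` S)) k) (card {i \<in> S. bip i})"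
    and "stanley_depth_ge (\<Union>(V ` S)) (edge_pow (\<Union>(V ` S)) (\<Union>(E ` S)) k) (card {i \<in> S. bip i})"
proof -
  have "(\<forall>k. stanley_depth_ge (\<Union>(V ` S)) (edge_layer (\<Union>(V ` S)) (\<Union>(E ` S)) k) (card {i \<in> S. bip i})) \<and>
    (\<forall>k. stanley_depth_ge (\<Union>(V ` S)) (edge_pow (\<Union>(V ` S)) (\<Union>(E ` S)) k) (card {i \<in> S. bip i}))"
    using assms(2-4)
  proof (induction S rule: finite_induct)
    case empty
    have "stanley_depth_ge {} (edge_layer ({} :: 'v set) {} k) 0" for k :: nat
      by (rule stanley_depth_ge_layer_0) auto
    moreover have "stanley_depth_ge {} (edge_pow ({} :: 'v set) {} k) 0" for k :: nat
    proof (rule stanley_depth_ge_0)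
      show "trunc_invariant (2 * k + 1) (edge_pow ({} :: 'v set) {} k)" by (rule trunc_invariant_edge_pow) simp
    qed (use edge_pow_subset_monomials in auto)
    ultimately show ?case by simp
  next
    case (insert i S)
    let ?Y = "\<Union>(V ` S)" and ?Q = "\<Union>(E ` S)" and ?e = "card {i \<in> S. bip i}"
    \<comment> \<open>A nonbipartite component contributes only the trivial bound, because
      \<open>koenig\<close> yields no cover for its layers.\<close>
    define d :: nat where "d = (if bip i then 1 else 0)"
    have "disjoint_family_on V S" using insert.prems(1) unfolding disjoint_family_on_def by blast
    then have IH: "stanley_depth_ge ?Y (edge_layer ?Y ?Q k) ?e" "stanley_depth_ge ?Y (edge_pow ?Y ?Q k) ?e" for k
      using insert.IH insert.prems(2) by auto
    have i: "finite (V i)" "V i \<noteq> {}" "E i \<subseteq> V i \<times> V i" using insert.prems(2)[of i] by auto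
    have "finite (V j)" "E j \<subseteq> V j \<times> V j" if "j \<in> S" for j using insert.prems(2)[of j] that by auto
    then have Y: "finite ?Y" "?Q \<subseteq> ?Y \<times> ?Y" using insert.hyps(1) by (simp, blast)
    have disj: "V i \<inter> ?Y = {}" using insert.prems(1) insert.hyps(2) unfolding disjoint_family_on_def by fastforce
    have card: "card {j \<in> insert i S. bip j} = d + ?e"
    proof (cases "bip i")
      case True
      then have "{j \<in> insert i S. bip j} = insert i {j \<in> S. bip j}" by auto
      then show ?thesis using True insert.hyps by (simp add: d_def)
    next
      case False
      then have "{j \<in> insert i S. bip j} = {j \<in> S. bip j}" by auto
      then show ?thesis using False by (simp add: d_def)
    qed
    have layer: "stanley_depth_ge (V i) (edge_layer (V i) (E i) k) d" for k
      using stanley_depth_ge_bipartite_layer[OF i(1,2) _ _ i(3)] stanley_depth_ge_layer_0[OF i(1,3)]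
      by (auto simp: d_def bip_def)
    have d1: "d \<le> 1" by (simp add: d_def)
    have pow: "stanley_depth_ge (V i) (edge_pow (V i) (E i) k) d" for k
      using stanley_depth_ge_edge_pow[OF i] d1 by (rule stanley_depth_ge_mono)
    have "d \<le> card (V i)" using i(1,2) d1 by (metis card_gt_0_iff less_eq_Suc_le One_nat_def le_trans)
    then have "stanley_depth_ge (V i \<union> ?Y) (edge_pow (V i \<union> ?Y) (E i \<union> ?Q) k) (d + ?e)" for k
      by (intro stanley_depth_ge_edge_pow_Un i Y disj pow IH)
    moreover have "stanley_depth_ge (V i \<union> ?Y) (edge_layer (V i \<union> ?Y) (E i \<union> ?Q) k) (d + ?e)" for k
      by (intro stanley_depth_ge_edge_layer_Un i Y disj layer IH)
    ultimately show ?case unfolding card by simp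
  qed
  then show "stanley_depth_ge (\<Union>(V ` S)) (edge_layer (\<Union>(V ` S)) (\<Union>(E ` S)) k) (card {i \<in> S. bip i})"
    and "stanley_depth_ge (\<Union>(V ` S)) (edge_pow (\<Union>(V ` S)) (\<Union>(E ` S)) k) (card {i \<in> S. bip i})"
    by blast+
qed

section \<open>Monomial ideals and Stanley decompositions\<close>

text \<open>The ideals and Stanley spaces below all take this form, which turns statements about
  vector spaces into statements about exponent sets.\<close>

definition poly_space :: "('v \<Rightarrow>\<^sub>0 nat) set \<Rightarrow> ('v, 'k::field) mpoly set" where
  "poly_space A = {p. Poly_Mapping.keys p \<subseteq> A}"

lemma poly_space_iff: "p \<in> poly_space A \<longleftrightarrow> (\<forall>m. m \<notin> A \<longrightarrow> Poly_Mapping.lookup p m = 0)"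
  by (auto simp: poly_space_def in_keys_iff)

lemma zero_poly_space [simp]: "0 \<in> poly_space A"
  by (simp add: poly_space_iff)

lemma poly_space_add: "p \<in> poly_space A \<Longrightarrow> q \<in> poly_space A \<Longrightarrow> p + q \<in> poly_space A"
  by (simp add: poly_space_iff lookup_add)

lemma single_poly_space_iff: "Poly_Mapping.single m c \<in> poly_space A \<longleftrightarrow> m \<in> A \<or> c = 0"
  by (auto simp: poly_space_iff lookup_single when_def)

lemma carrier_poly_ring: "carrier (poly_ring X) = poly_space (monomials X)"
  by (auto simp: poly_ring_def poly_space_def monomials_def)

lemma poly_space_induct [consumes 1, case_names zero single add]:
  fixes p :: "('v, 'k::field) mpoly"
  assumes "p \<in> poly_space A" and "P 0"
    and "\<And>m c. m \<in> A \<Longrightarrow> P (Poly_Mapping.single m c)"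
    and "\<And>p q. P p \<Longrightarrow> P q \<Longrightarrow> P (p + q)"
  shows "P p"
proof -
  have "P p" if "finite K" "Poly_Mapping.keys p \<subseteq> K" "K \<subseteq> A" for K and p :: "('v, 'k) mpoly"
    using that
  proof (induction K arbitrary: p rule: finite_induct)
    case empty
    then show ?case using assms(2) by simp
  next
    case (insert m K)
    let ?q = "restrict_exp (- {m}) p"
    have "x \<in> Poly_Mapping.keys ?q \<Longrightarrow> x \<in> Poly_Mapping.keys p \<and> x \<noteq> m" for x
      by (simp add: in_keys_iff lookup_restrict_exp when_def split: if_splits)
    then have "Poly_Mapping.keys ?q \<subseteq> K" using insert.prems(1) by blast
    then have "P ?q" using insert.IH insert.prems(2) by blast
    moreover have "P (Poly_Mapping.single m (Poly_Mapping.lookup p m))"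
      using insert.prems(2) assms(3) by simp
    moreover have "p = Poly_Mapping.single m (Poly_Mapping.lookup p m) + ?q"
      by (rule poly_mapping_eqI) (auto simp: lookup_add lookup_restrict_exp lookup_single when_def)
    ultimately show ?case using assms(4) by metis
  qed
  from this[of "Poly_Mapping.keys p" p] show ?thesis using assms(1) by (simp add: poly_space_def)
qed

lemma poly_space_mult:
  assumes "p \<in> poly_space A" "q \<in> poly_space B" "\<And>a b. a \<in> A \<Longrightarrow> b \<in> B \<Longrightarrow> a + b \<in> C"
  shows "p * q \<in> poly_space C"
proof -
  have "m \<in> C" if "m \<in> Poly_Mapping.keys (p * q)" for m
    using that keys_mult[of p q] assms unfolding poly_space_def by blast
  then show ?thesis by (auto simp: poly_space_def)
qed

lemma ideal_poly_space:
  assumes A: "A \<subseteq> monomials X" and closed: "\<And>a b. a \<in> A \<Longrightarrow> b \<in> monomials X \<Longrightarrow> a + b \<in> A"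
  shows "ideal (poly_space A :: ('v, 'k::field) mpoly set) (poly_ring X)"
proof -
  interpret cring "poly_ring X :: ('v, 'k) mpoly ring" by (rule cring_poly_ring)
  have inv: "inv\<^bsub>add_monoid (poly_ring X)\<^esub> p = - p" if "p \<in> carrier (poly_ring X)" for p :: "('v, 'k) mpoly"
  proof -
    have "\<ominus>\<^bsub>poly_ring X\<^esub> p = - p"
    proof (rule minus_equality)
      show "- p \<oplus>\<^bsub>poly_ring X\<^esub> p = \<zero>\<^bsub>poly_ring X\<^esub>" by (simp add: poly_ring_def)
      show "- p \<in> carrier (poly_ring X)" using that by (simp add: poly_ring_def)
    qed (rule that)
    then show ?thesis by (simp add: a_inv_def)
  qed
  have sub: "poly_space A \<subseteq> carrier (poly_ring X :: ('v, 'k) mpoly ring)"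
    using A by (auto simp: carrier_poly_ring poly_space_def)
  show ?thesis
  proof (rule idealI)
    show "subgroup (poly_space A :: ('v, 'k) mpoly set) (add_monoid (poly_ring X))"
    proof
      show "poly_space A \<subseteq> carrier (add_monoid (poly_ring X) :: ('v, 'k) mpoly monoid)"
        using sub by simp
      show "p \<otimes>\<^bsub>add_monoid (poly_ring X)\<^esub> q \<in> poly_space A" if "p \<in> poly_space A" "q \<in> poly_space A"
        for p q :: "('v, 'k) mpoly"
        using poly_space_add[OF that] by (simp add: poly_ring_def)
      show "\<one>\<^bsub>add_monoid (poly_ring X)\<^esub> \<in> (poly_space A :: ('v, 'k) mpoly set)"
        by (simp add: poly_ring_def)
      show "inv\<^bsub>add_monoid (poly_ring X)\<^esub> p \<in> poly_space A" if "p \<in> poly_space A" for p :: "('v, 'k) mpoly"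
      proof -
        have "- p \<in> poly_space A" using that by (simp add: poly_space_iff)
        then show ?thesis using inv[of p] that sub by (metis subsetD)
      qed
    qed
    fix p q :: "('v, 'k) mpoly" assume "p \<in> poly_space A" "q \<in> carrier (poly_ring X)"
    then have "p * q \<in> poly_space A"
      unfolding carrier_poly_ring by (rule poly_space_mult) (rule closed)
    then show "p \<otimes>\<^bsub>poly_ring X\<^esub> q \<in> poly_space A" "q \<otimes>\<^bsub>poly_ring X\<^esub> p \<in> poly_space A"
      by (simp_all add: poly_ring_def mult.commute)
  qed (rule ring_axioms)
qed

lemma ideal_edge_pow:
  "R \<subseteq> X \<times> X \<Longrightarrow> ideal (poly_space (edge_pow X R k) :: ('v, 'k::field) mpoly set) (poly_ring X)"
  by (intro ideal_poly_space edge_pow_subset_monomials edge_pow_add_monomial)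

lemma edge_ideal_conv:
  assumes "wf_digraph G"
  shows "(edge_ideal G :: ('v, 'k::field) mpoly set) = poly_space (edge_pow (verts G) (arcs_ends G) 1)"
proof -
  let ?X = "verts G" and ?R = "arcs_ends G"
  let ?S = "{var u * var v | u v. u \<rightarrow>\<^bsub>G\<^esub> v} :: ('v, 'k) mpoly set"
  interpret G: wf_digraph G by (rule assms)
  interpret cring "poly_ring ?X :: ('v, 'k) mpoly ring" by (rule cring_poly_ring)
  have R: "?R \<subseteq> ?X \<times> ?X" by (auto simp: arcs_ends_conv)
  have varmult: "(var u * var v :: ('v, 'k) mpoly) = Poly_Mapping.single (unit_vec u + unit_vec v) 1" for u v
    by (simp add: var_def mult_single)
  have gen: "?S \<subseteq> poly_space (edge_pow ?X ?R 1)"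
    using edge_pow_SucI[of 0 ?X ?R 0] by (auto simp: varmult single_poly_space_iff)
  also have "\<dots> \<subseteq> carrier (poly_ring ?X)"
    using edge_pow_subset_monomials[OF R, of 1] by (auto simp: carrier_poly_ring poly_space_def)
  finally have SC: "?S \<subseteq> carrier (poly_ring ?X)" .
  have I: "ideal (Idl\<^bsub>poly_ring ?X\<^esub> ?S) (poly_ring ?X)" by (rule genideal_ideal[OF SC])
  show ?thesis
    unfolding edge_ideal_def
  proof (intro equalityI subsetI)
    fix p assume "p \<in> Idl\<^bsub>poly_ring ?X\<^esub> ?S"
    then show "p \<in> poly_space (edge_pow ?X ?R 1)"
      using genideal_minimal[OF ideal_edge_pow[OF R] gen] by blast
  next
    fix p :: "('v, 'k) mpoly" assume "p \<in> poly_space (edge_pow ?X ?R 1)"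
    then show "p \<in> Idl\<^bsub>poly_ring ?X\<^esub> ?S"
    proof (induction rule: poly_space_induct)
      case zero
      show ?case using additive_subgroup.zero_closed[OF ideal.axioms(1)[OF I]] by (simp add: poly_ring_def)
    next
      case (single m c)
      then have "m \<in> edge_pow ?X ?R (Suc 0)" by simp
      then obtain a u v where a: "a \<in> monomials ?X" "u \<rightarrow>\<^bsub>G\<^esub> v" "m = a + unit_vec u + unit_vec v"
        by (auto elim!: edge_pow_SucE)
      have "var u * var v \<in> Idl\<^bsub>poly_ring ?X\<^esub> ?S" using genideal_self[OF SC] a(2) by blast
      moreover have "Poly_Mapping.single a c \<in> carrier (poly_ring ?X)"
        using a(1) by (simp add: carrier_poly_ring single_poly_space_iff)
      ultimately have "Poly_Mapping.single a c \<otimes>\<^bsub>poly_ring ?X\<^esub> (var u * var v) \<in> Idl\<^bsub>poly_ring ?X\<^esub> ?S"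
        by (rule ideal.I_l_closed[OF I])
      then show ?case by (simp add: poly_ring_def varmult mult_single a(3) add.assoc)
    next
      case (add p q)
      then show ?case
        using additive_subgroup.a_closed[OF ideal.axioms(1)[OF I], of p q] by (simp add: poly_ring_def)
    qed
  qed
qed

lemma ideal_power_conv:
  assumes R: "R \<subseteq> X \<times> X"
  shows "ideal_power X (poly_space (edge_pow X R 1) :: ('v, 'k::field) mpoly set) k = poly_space (edge_pow X R k)"
proof (induction k)
  case 0
  \<comment> \<open>The zeroth power in the monoid of ideals is the whole ring, in agreement with
    the base case of \<open>edge_pow\<close>.\<close>
  show ?case by (simp add: ideal_power_def nat_pow_def ideals_set_def carrier_poly_ring)
next
  case (Suc k)
  let ?E = "\<lambda>k. poly_space (edge_pow X R k) :: ('v, 'k) mpoly set"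
  have "ideal_power X (?E 1) (Suc k) = ideal_prod (poly_ring X) (ideal_power X (?E 1) k) (?E 1)"
    by (simp add: ideal_power_def nat_pow_def ideals_set_def)
  also have "\<dots> = ideal_prod (poly_ring X) (?E k) (?E 1)" unfolding Suc ..
  also have "\<dots> = ?E (Suc k)"
  proof (intro equalityI subsetI)
    fix p assume "p \<in> ideal_prod (poly_ring X) (?E k) (?E 1)"
    then show "p \<in> ?E (Suc k)"
    proof (induction rule: ideal_prod.induct)
      case (prod i j)
      then have "i * j \<in> ?E (Suc k)"
        using edge_pow_add[OF R, of _ k _ 1] by (intro poly_space_mult) auto
      then show ?case by (simp add: poly_ring_def)
    next
      case (sum s t)
      then show ?case using poly_space_add[of s _ t] by (simp add: poly_ring_def)
    qed
  next
    fix p assume "p \<in> ?E (Suc k)"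
    then show "p \<in> ideal_prod (poly_ring X) (?E k) (?E 1)"
    proof (induction rule: poly_space_induct)
      case zero
      show ?case using ideal_prod.prod[of 0 "?E k" 0 "?E 1" "poly_ring X"] by (simp add: poly_ring_def)
    next
      case (single m c)
      then obtain a u v where a: "a \<in> edge_pow X R k" "(u, v) \<in> R" "m = a + unit_vec u + unit_vec v"
        by (auto elim: edge_pow_SucE)
      have "unit_vec u + unit_vec v \<in> edge_pow X R 1"
        using edge_pow_SucI[of 0 X R 0, OF _ a(2)] by simp
      then have "Poly_Mapping.single (unit_vec u + unit_vec v) 1 \<in> ?E 1" "Poly_Mapping.single a c \<in> ?E k"
        using a(1) by (simp_all add: single_poly_space_iff)
      from ideal_prod.prod[OF this(2,1), of "poly_ring X"]
      show ?case by (simp add: poly_ring_def mult_single a(3) add.assoc)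
    next
      case (add p q)
      then show ?case using ideal_prod.sum[of p "poly_ring X" "?E k" "?E 1" q] by (simp add: poly_ring_def)
    qed
  qed
  finally show ?case .
qed

section \<open>Stanley spaces of monomials and their direct sums\<close>

lemma lookup_single_mult:
  fixes v :: "('v, 'k::field) mpoly"
  shows "Poly_Mapping.lookup (Poly_Mapping.single a c * v) (a + b) = c * Poly_Mapping.lookup v b"
proof -
  have "v \<in> poly_space UNIV" by (simp add: poly_space_def)
  then show ?thesis
  proof (induction rule: poly_space_induct)
    case (single m d)
    show ?case by (simp add: mult_single lookup_single when_def)
  next
    case (add p q)
    then show ?case by (simp add: distrib_left lookup_add)
  qed simp
qed

lemma single_mult_cancel:
  fixes v w :: "('v, 'k::field) mpoly"
  assumes "c \<noteq> 0" "Poly_Mapping.single a c * v = Poly_Mapping.single a c * w"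
  shows "v = w"
proof (rule poly_mapping_eqI)
  fix b
  show "Poly_Mapping.lookup v b = Poly_Mapping.lookup w b"
    using lookup_single_mult[of a c v b] lookup_single_mult[of a c w b] assms by simp
qed

lemma mult_space_single:
  assumes "c \<noteq> 0"
  shows "mult_space (Poly_Mapping.single a c :: ('v, 'k::field) mpoly) Z = poly_space (cone a Z)"
proof (intro equalityI subsetI)
  fix p :: "('v, 'k) mpoly" assume "p \<in> mult_space (Poly_Mapping.single a c) Z"
  then obtain v where v: "p = Poly_Mapping.single a c * v" "v \<in> poly_space (monomials Z)"
    by (auto simp: mult_space_def carrier_poly_ring)
  have "Poly_Mapping.single a c \<in> poly_space {a}" by (simp add: single_poly_space_iff)
  then show "p \<in> poly_space (cone a Z)"
    unfolding v(1) using v(2) by (rule poly_space_mult) (auto simp: cone_def)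
next
  fix p :: "('v, 'k) mpoly" assume "p \<in> poly_space (cone a Z)"
  then show "p \<in> mult_space (Poly_Mapping.single a c) Z"
  proof (induction rule: poly_space_induct)
    case zero
    show ?case unfolding mult_space_def carrier_poly_ring by (intro CollectI exI[of _ 0]) simp
  next
    case (single m d)
    then obtain b where b: "m = a + b" "b \<in> monomials Z" by (auto simp: cone_def)
    have "Poly_Mapping.single m d = Poly_Mapping.single a c * Poly_Mapping.single b (d / c)"
      using assms by (simp add: mult_single b(1))
    moreover have "Poly_Mapping.single b (d / c) \<in> poly_space (monomials Z)"
      using b(2) by (simp add: single_poly_space_iff)
    ultimately show ?case unfolding mult_space_def carrier_poly_ring by blast
  next
    case (add p q)
    then obtain v w where "p = Poly_Mapping.single a c * v" "v \<in> poly_space (monomials Z)"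
      "q = Poly_Mapping.single a c * w" "w \<in> poly_space (monomials Z)"
      by (auto simp: mult_space_def carrier_poly_ring)
    then have "p + q = Poly_Mapping.single a c * (v + w)" "v + w \<in> poly_space (monomials Z)"
      by (simp_all add: distrib_left poly_space_add)
    then show ?case unfolding mult_space_def carrier_poly_ring by blast
  qed
qed

lemma mult_space_zero: "mult_space 0 Z = {0 :: ('v, 'k::field) mpoly}"
  unfolding mult_space_def carrier_poly_ring by (auto intro: exI[of _ 0])

text \<open>The generator alone is a basis; uniqueness of its coefficient is cancellation of a
  nonzero term.\<close>

lemma free_over_mult_space:
  assumes c: "c \<noteq> 0"
  shows "free_over (carrier (poly_ring Z)) (mult_space (Poly_Mapping.single a c :: ('v, 'k::field) mpoly) Z)"
proof -
  let ?u = "Poly_Mapping.single a c :: ('v, 'k) mpoly"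
  have u: "?u \<in> mult_space ?u Z" by (simp add: mult_space_single[OF c] single_poly_space_iff)
  have sum: "(\<Sum>b \<in> Poly_Mapping.keys C. Poly_Mapping.lookup C b * b) = ?u * Poly_Mapping.lookup C ?u"
    if "Poly_Mapping.keys C \<subseteq> {?u}" for C :: "('v, 'k) mpoly \<Rightarrow>\<^sub>0 ('v, 'k) mpoly"
  proof -
    have "(\<Sum>b \<in> Poly_Mapping.keys C. Poly_Mapping.lookup C b * b) = (\<Sum>b \<in> {?u}. Poly_Mapping.lookup C b * b)"
      by (rule sum.mono_neutral_left) (use that in \<open>auto simp: in_keys_iff\<close>)
    then show ?thesis by (simp add: mult.commute)
  qed
  show ?thesis
    unfolding free_over_def
  proof (intro exI[of _ "{?u}"] conjI ballI)
    fix x assume "x \<in> mult_space ?u Z"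
    then obtain v where v: "x = ?u * v" "v \<in> carrier (poly_ring Z)" by (auto simp: mult_space_def)
    let ?C = "Poly_Mapping.single ?u v"
    show "\<exists>!C. Poly_Mapping.keys C \<subseteq> {?u} \<and> (\<forall>b. Poly_Mapping.lookup C b \<in> carrier (poly_ring Z)) \<and>
        x = (\<Sum>b \<in> Poly_Mapping.keys C. Poly_Mapping.lookup C b * b)"
    proof (rule ex1I[of _ ?C])
      have "Poly_Mapping.keys ?C \<subseteq> {?u}" by simp
      moreover have "Poly_Mapping.lookup ?C b \<in> carrier (poly_ring Z)" for b
        using v(2) by (simp add: lookup_single when_def carrier_poly_ring)
      ultimately show "Poly_Mapping.keys ?C \<subseteq> {?u} \<and> (\<forall>b. Poly_Mapping.lookup ?C b \<in> carrier (poly_ring Z)) \<and>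
          x = (\<Sum>b \<in> Poly_Mapping.keys ?C. Poly_Mapping.lookup ?C b * b)"
        using sum[of ?C] v(1) by simp
    next
      fix C assume C: "Poly_Mapping.keys C \<subseteq> {?u} \<and> (\<forall>b. Poly_Mapping.lookup C b \<in> carrier (poly_ring Z)) \<and>
          x = (\<Sum>b \<in> Poly_Mapping.keys C. Poly_Mapping.lookup C b * b)"
      then have "?u * Poly_Mapping.lookup C ?u = ?u * v" using sum[of C] v(1) by simp
      then have "Poly_Mapping.lookup C ?u = v" by (rule single_mult_cancel[OF c])
      moreover have "Poly_Mapping.lookup C b = 0" if "b \<noteq> ?u" for b
        using C that by (auto simp: in_keys_iff)
      ultimately show "C = ?C"
        by (intro poly_mapping_eqI) (auto simp: lookup_single when_def)
    qed
  qed (use u in simp)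
qed

text \<open>Every monomial of the union lies in exactly one \<open>K d\<close>, so the component at
  \<open>d\<close> is forced to be the restriction of \<open>x\<close> to
  \<open>K d\<close>.\<close>

lemma poly_space_decompose:
  fixes x :: "('v, 'k::field) mpoly"
  assumes "finite D" "disjoint_family_on K D" "x \<in> poly_space (\<Union>d\<in>D. K d)"
  shows "\<exists>!f. f \<in> (\<Pi>\<^sub>E d\<in>D. poly_space (K d)) \<and> x = (\<Sum>d\<in>D. f d)"
proof -
  have component: "Poly_Mapping.lookup (\<Sum>d\<in>D. f d) m = Poly_Mapping.lookup (f e) m"
    if f: "\<And>d. d \<in> D \<Longrightarrow> f d \<in> poly_space (K d)" and e: "e \<in> D" "m \<in> K e"
    for f :: "'a \<Rightarrow> ('v, 'k) mpoly" and e m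
  proof -
    have "Poly_Mapping.lookup (f d) m = 0" if "d \<in> D - {e}" for d
    proof -
      have "m \<notin> K d" using that e assms(2) unfolding disjoint_family_on_def by blast
      then show ?thesis using f[of d] that by (simp add: poly_space_iff)
    qed
    then show ?thesis unfolding lookup_sum using assms(1) e(1) by (simp add: sum.remove[of D e])
  qed
  show ?thesis
  proof (rule ex1I[of _ "\<lambda>d\<in>D. restrict_exp (K d) x"])
    let ?f = "\<lambda>d\<in>D. restrict_exp (K d) x"
    have mem: "?f \<in> (\<Pi>\<^sub>E d\<in>D. poly_space (K d))"
      by (auto simp: poly_space_iff lookup_restrict_exp)
    have "x = (\<Sum>d\<in>D. ?f d)"
    proof (rule poly_mapping_eqI)
      fix m
      show "Poly_Mapping.lookup x m = Poly_Mapping.lookup (\<Sum>d\<in>D. ?f d) m"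
      proof (cases "\<exists>e\<in>D. m \<in> K e")
        case True
        then obtain e where e: "e \<in> D" "m \<in> K e" by blast
        have "Poly_Mapping.lookup (\<Sum>d\<in>D. ?f d) m = Poly_Mapping.lookup (?f e) m"
          using mem e by (intro component) auto
        then show ?thesis using e by (simp add: lookup_restrict_exp)
      next
        case False
        then show ?thesis using assms(3) by (auto simp: lookup_sum lookup_restrict_exp poly_space_iff)
      qed
    qed
    then show "?f \<in> (\<Pi>\<^sub>E d\<in>D. poly_space (K d)) \<and> x = (\<Sum>d\<in>D. ?f d)" using mem by blast
    fix f assume f: "f \<in> (\<Pi>\<^sub>E d\<in>D. poly_space (K d)) \<and> x = (\<Sum>d\<in>D. f d)"
    have fd: "f d \<in> poly_space (K d)" if "d \<in> D" for d using f that by (blast dest: PiE_mem)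
    show "f = ?f"
    proof (rule PiE_ext[of f D "\<lambda>d. poly_space (K d)"])
      fix d assume d: "d \<in> D"
      show "f d = ?f d"
      proof (rule poly_mapping_eqI)
        fix m
        show "Poly_Mapping.lookup (f d) m = Poly_Mapping.lookup (?f d) m"
        proof (cases "m \<in> K d")
          case True
          have "Poly_Mapping.lookup x m = Poly_Mapping.lookup (f d) m"
            using f component[OF fd d True] by simp
          then show ?thesis using d True by (simp add: lookup_restrict_exp)
        next
          case False
          then show ?thesis using fd[OF d] d by (simp add: poly_space_iff lookup_restrict_exp)
        qed
      qed
    qed (use f mem in auto)
  qed
qed

text \<open>Reads the cone back from the space, so that exponent sets can be indexed by the pairs of
  a decomposition without choosing an apex.\<close>

definition mult_space_exps :: "('v, 'k::field) mpoly \<Rightarrow> 'v set \<Rightarrow> ('v \<Rightarrow>\<^sub>0 nat) set" where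
  "mult_space_exps u Z = {m. Poly_Mapping.single m 1 \<in> mult_space u Z}"

lemma stanley_decomposition_of_partition:
  assumes P: "stanley_partition X A P"
  shows "stanley_decomposition X (poly_space A :: ('v, 'k::field) mpoly set)
    ((\<lambda>(a, Z). (Poly_Mapping.single a 1, Z)) ` P)" (is "stanley_decomposition _ _ ?D")
proof -
  define K where "K d = mult_space_exps (fst d) (snd d)" for d :: "('v, 'k) mpoly \<times> 'v set"
  have K: "K (Poly_Mapping.single a 1, Z) = cone a Z" for a Z
    by (simp add: K_def mult_space_exps_def mult_space_single single_poly_space_iff)
  have mult: "(case d of (u, Z) \<Rightarrow> mult_space u Z) = poly_space (K d)" if "d \<in> ?D" for d
    using that by (auto simp: K mult_space_single)
  have PiE: "(\<Pi>\<^sub>E (u, Z) \<in> ?D. mult_space u Z) = (\<Pi>\<^sub>E d \<in> ?D. poly_space (K d))"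
    by (rule PiE_cong) (rule mult)
  have fin: "finite ?D" using stanley_partitionD(1)[OF P] by simp
  have disj: "disjoint_family_on K ?D"
    unfolding disjoint_family_on_def
  proof (intro ballI impI equals0I)
    fix d e m assume "d \<in> ?D" "e \<in> ?D" "d \<noteq> e" "m \<in> K d \<inter> K e"
    then show False using stanley_partitionD(4)[OF P] by (auto simp: K) blast+
  qed
  have "(\<Union>d\<in>?D. K d) = A"
    using stanley_partitionD(3)[OF P] by (auto simp: K)
  then have ex1: "\<exists>!f. f \<in> (\<Pi>\<^sub>E (u, Z) \<in> ?D. mult_space u Z) \<and> x = (\<Sum>d\<in>?D. f d)"
    if "x \<in> poly_space A" for x
    using poly_space_decompose[OF fin disj, of x] that unfolding PiE by simp
  have "stanley_space X (poly_space A) u Z \<and> mult_space u Z \<subseteq> poly_space A" if uZ: "(u, Z) \<in> ?D" for u Z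
  proof -
    obtain a where a: "(a, Z) \<in> P" "u = Poly_Mapping.single a 1" using uZ by auto
    have "cone a Z \<subseteq> A" "Z \<subseteq> X"
      using stanley_partition_cone_subset[OF P a(1)] stanley_partitionD(2)[OF P a(1)] by auto
    then show ?thesis
      using self_in_cone[of a Z] free_over_mult_space[of 1 Z a]
      unfolding stanley_space_def homogeneous_def a(2) mult_space_single[OF one_neq_zero]
      by (auto simp: single_poly_space_iff poly_space_def)
  qed
  then show ?thesis
    unfolding stanley_decomposition_def using fin ex1 by (intro conjI ballI) (auto simp: case_prod_beta)
qed

text \<open>
  A decomposition may contain degenerate pairs \<open>(0, Z)\<close>, whose space is \<open>{0}\<close>; dropping them does
  not lower the minimal dimension.
\<close>

lemma stanley_partition_of_decomposition:
  assumes D: "stanley_decomposition X (poly_space A :: ('v, 'k::field) mpoly set) D"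
  defines "P \<equiv> (\<lambda>(u, Z). (the_elem (Poly_Mapping.keys u), Z)) ` {(u, Z) \<in> D. u \<noteq> 0}"
  shows "stanley_partition X A P"
proof -
  have fin: "finite D"
    and space: "\<And>u Z. (u, Z) \<in> D \<Longrightarrow> stanley_space X (poly_space A) u Z \<and> mult_space u Z \<subseteq> poly_space A"
    and ex1: "\<And>x. x \<in> poly_space A \<Longrightarrow> \<exists>!f. f \<in> (\<Pi>\<^sub>E (u, Z) \<in> D. mult_space u Z) \<and> x = (\<Sum>d \<in> D. f d)"
    using D unfolding stanley_decomposition_def by auto
  have PE: "\<exists>u. (u, Z) \<in> D \<and> mult_space u Z = poly_space (cone a Z)" if aZ: "(a, Z) \<in> P" for a Z
  proof -
    obtain u where u: "(u, Z) \<in> D" "u \<noteq> 0" "a = the_elem (Poly_Mapping.keys u)"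
      using aZ unfolding P_def by auto
    obtain b c where "u = Poly_Mapping.single b c"
      using space[OF u(1)] by (auto simp: stanley_space_def homogeneous_def)
    then show ?thesis using u mult_space_single[of c b Z] by auto
  qed
  have PI: "\<exists>a. (a, Z) \<in> P \<and> mult_space u Z = poly_space (cone a Z)" if uZ: "(u, Z) \<in> D" "u \<noteq> 0" for u Z
  proof -
    obtain b c where bc: "u = Poly_Mapping.single b c"
      using space[OF uZ(1)] by (auto simp: stanley_space_def homogeneous_def)
    then have "c \<noteq> 0" using uZ(2) by auto
    then have "the_elem (Poly_Mapping.keys u) = b" using bc by simp
    then have "(b, Z) \<in> P" using uZ unfolding P_def by force
    then show ?thesis using mult_space_single[OF \<open>c \<noteq> 0\<close>] bc by blast
  qed
  have zero: "0 \<in> mult_space u Z" for u :: "('v, 'k) mpoly" and Z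
    unfolding mult_space_def carrier_poly_ring by (intro CollectI exI[of _ 0]) simp
  \<comment> \<open>Two distinct summands sharing a nonzero \<open>x\<close> would give two
    decompositions of \<open>x\<close>, with all of \<open>x\<close> placed in one summand or in the
    other.\<close>
  have uniq: "d = e" if d: "d \<in> D" "x \<in> mult_space (fst d) (snd d)"
    and e: "e \<in> D" "x \<in> mult_space (fst e) (snd e)" and x: "x \<noteq> 0" for d e x
  proof (rule ccontr)
    assume "d \<noteq> e"
    have "x \<in> poly_space A" using d space[of "fst d" "snd d"] by auto
    have "(\<lambda>y\<in>D. if y = i then x else 0) \<in> (\<Pi>\<^sub>E (u, Z) \<in> D. mult_space u Z) \<and>
        x = (\<Sum>y \<in> D. (\<lambda>y\<in>D. if y = i then x else 0) y)" if "i = d \<or> i = e" for i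
    proof
      show "(\<lambda>y\<in>D. if y = i then x else 0) \<in> (\<Pi>\<^sub>E (u, Z) \<in> D. mult_space u Z)"
        using that d e zero by (auto simp: case_prod_beta)
      have "i \<in> D" using that d e by auto
      then show "x = (\<Sum>y \<in> D. (\<lambda>y\<in>D. if y = i then x else 0) y)"
        using fin by simp
    qed
    then have "(\<lambda>y\<in>D. if y = d then x else 0) = (\<lambda>y\<in>D. if y = e then x else 0)"
      using ex1[OF \<open>x \<in> poly_space A\<close>] by blast
    from fun_cong[OF this, of d] show False using d(1) x \<open>d \<noteq> e\<close> by simp
  qed
  show ?thesis
  proof (rule stanley_partitionI)
    show "finite P" unfolding P_def by (rule finite_imageI) (rule finite_subset[OF _ fin], auto)
    show "Z \<subseteq> X" if "(a, Z) \<in> P" for a Z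
      using PE[OF that] space by (auto simp: stanley_space_def)
  next
    fix m a Z b W
    assume aZ: "(a, Z) \<in> P" and bW: "(b, W) \<in> P" and m: "m \<in> cone a Z" "m \<in> cone b W"
    obtain u where u: "(u, Z) \<in> D" "mult_space u Z = poly_space (cone a Z)" using PE[OF aZ] by blast
    obtain w where w: "(w, W) \<in> D" "mult_space w W = poly_space (cone b W)" using PE[OF bW] by blast
    have "Poly_Mapping.single m (1 :: 'k) \<noteq> 0" by (metis lookup_single_eq lookup_zero zero_neq_one)
    then have "(u, Z) = (w, W)"
      using m u w by (intro uniq[of _ "Poly_Mapping.single m 1"]) (auto simp: single_poly_space_iff)
    then have "poly_space (cone a Z) = (poly_space (cone b W) :: ('v, 'k) mpoly set)" "Z = W"
      using u w by auto
    \<comment> \<open>Equality of the spaces puts each apex into the cone of the other, and mutual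
      divisibility identifies them.\<close>
    then have "Poly_Mapping.single a 1 \<in> (poly_space (cone b Z) :: ('v, 'k) mpoly set)"
      "Poly_Mapping.single b 1 \<in> (poly_space (cone a Z) :: ('v, 'k) mpoly set)"
      by (metis single_poly_space_iff self_in_cone)+
    then have "a \<in> cone b Z" "b \<in> cone a Z" by (simp_all add: single_poly_space_iff)
    then have "a = b" by (intro poly_mapping_eqI) (metis cone_iff le_antisym)
    then show "a = b \<and> Z = W" using \<open>Z = W\<close> by blast
  next
    show "A = (\<Union>(a, Z)\<in>P. cone a Z)"
    proof (intro equalityI subsetI)
      fix m assume "m \<in> A"
      then have "Poly_Mapping.single m 1 \<in> (poly_space A :: ('v, 'k) mpoly set)"
        by (simp add: single_poly_space_iff)
      from ex1[OF this] obtain f where f: "f \<in> (\<Pi>\<^sub>E (u, Z) \<in> D. mult_space u Z)"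
        "(Poly_Mapping.single m 1 :: ('v, 'k) mpoly) = (\<Sum>d \<in> D. f d)" by blast
      \<comment> \<open>Some summand has \<open>m\<close> in its support; this excludes a zero
        generator and places \<open>m\<close> in the cone of that summand.\<close>
      have "Poly_Mapping.lookup (\<Sum>d \<in> D. f d) m \<noteq> 0" unfolding f(2)[symmetric] by simp
      then obtain d where d: "d \<in> D" "Poly_Mapping.lookup (f d) m \<noteq> 0"
        unfolding lookup_sum by (metis (no_types, lifting) sum.neutral)
      obtain u Z where uZ: "d = (u, Z)" by force
      have fd: "f d \<in> mult_space u Z" using PiE_mem[OF f(1) d(1)] uZ by simp
      have "u \<noteq> 0" using fd d(2) by (auto simp: mult_space_zero)
      then obtain a where "(a, Z) \<in> P" "mult_space u Z = poly_space (cone a Z)"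
        using PI[of u Z] d(1) uZ by blast
      then show "m \<in> (\<Union>(a, Z)\<in>P. cone a Z)" using fd d(2) by (auto simp: poly_space_iff)
    next
      fix m assume "m \<in> (\<Union>(a, Z)\<in>P. cone a Z)"
      then obtain a Z where aZ: "(a, Z) \<in> P" "m \<in> cone a Z" by blast
      obtain u where u: "(u, Z) \<in> D" "mult_space u Z = poly_space (cone a Z)" using PE[OF aZ(1)] by blast
      have "Poly_Mapping.single m 1 \<in> mult_space u Z" unfolding u(2) using aZ(2) by (simp add: single_poly_space_iff)
      then show "m \<in> A" using space[OF u(1)] by (auto simp: single_poly_space_iff)
    qed
  qed
qed

section \<open>Comparison of cone partitions with \<open>sdepth\<close>\<close>

lemma stanley_depth_ge_le_card:
  assumes "finite X" "A \<noteq> {}" "stanley_depth_ge X A d" shows "d \<le> card X"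
proof -
  obtain P where P: "stanley_partition X A P" "\<forall>(a, Z) \<in> P. d \<le> card Z"
    using assms(3) unfolding stanley_depth_ge_def by blast
  have "P \<noteq> {}" using stanley_partitionD(3)[OF P(1)] assms(2) by auto
  then obtain a Z where aZ: "(a, Z) \<in> P" by auto
  have "d \<le> card Z" using P(2) aZ by blast
  also have "card Z \<le> card X" using stanley_partitionD(2)[OF P(1) aZ] assms(1) by (rule card_mono[rotated])
  finally show ?thesis .
qed

text \<open>Needed for the \<open>Max\<close> in \<open>sdepth\<close> to be meaningful.
  Nonemptiness of \<open>A\<close> excludes the empty decomposition, whose \<open>Min\<close> is
  unspecified; every other value is at most \<open>card X\<close>.\<close>

lemma finite_sdepths:
  assumes X: "finite X" and A: "A \<noteq> {}"
  shows "finite {sdepth_decomposition D | D. stanley_decomposition X (poly_space A :: ('v, 'k::field) mpoly set) D}"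
    (is "finite ?S")
proof (rule finite_subset)
  show "?S \<subseteq> {..card X}"
  proof
    fix s assume "s \<in> ?S"
    then obtain D where D: "stanley_decomposition X (poly_space A :: ('v, 'k) mpoly set) D"
      "s = sdepth_decomposition D" by blast
    have "D \<noteq> {}"
    proof
      assume "D = {}"
      then have "stanley_partition X A {}" using stanley_partition_of_decomposition[OF D(1)] by simp
      then show False using A stanley_partitionD(3) by blast
    qed
    then obtain u Z where uZ: "(u, Z) \<in> D" by auto
    have "Z \<subseteq> X" "finite D" using D(1) uZ unfolding stanley_decomposition_def stanley_space_def by auto
    have "s \<le> card Z"
      unfolding D(2) sdepth_decomposition_def using \<open>finite D\<close> uZ by (intro Min_le) force+
    also have "card Z \<le> card X" using \<open>Z \<subseteq> X\<close> X by (rule card_mono[rotated])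
    finally show "s \<in> {..card X}" by simp
  qed
qed simp

lemma sdepth_ge:
  assumes X: "finite X" and A: "A \<noteq> {}" and d: "stanley_depth_ge X A d"
  shows "d \<le> sdepth X (poly_space A :: ('v, 'k::field) mpoly set)"
proof -
  obtain P where P: "stanley_partition X A P" "\<forall>(a, Z) \<in> P. d \<le> card Z"
    using d unfolding stanley_depth_ge_def by blast
  let ?D = "(\<lambda>(a, Z). (Poly_Mapping.single a 1 :: ('v, 'k) mpoly, Z)) ` P"
  have "P \<noteq> {}" using stanley_partitionD(3)[OF P(1)] A by auto
  then have "d \<le> sdepth_decomposition ?D"
    unfolding sdepth_decomposition_def using stanley_partitionD(1)[OF P(1)] P(2)
    by (intro Min.boundedI) auto
  also have "\<dots> \<le> sdepth X (poly_space A :: ('v, 'k) mpoly set)"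
    unfolding sdepth_def using stanley_decomposition_of_partition[OF P(1)]
    by (intro Max_ge finite_sdepths[OF X A]) blast
  finally show ?thesis .
qed

text \<open>The given bound provides one decomposition, so the maximum is taken over a nonempty
  finite set and is attained.\<close>

lemma stanley_depth_ge_sdepth:
  assumes X: "finite X" and A: "A \<noteq> {}" and "stanley_depth_ge X A d"
  shows "stanley_depth_ge X A (sdepth X (poly_space A :: ('v, 'k::field) mpoly set))"
proof -
  obtain P where "stanley_partition X A P" using assms(3) unfolding stanley_depth_ge_def by blast
  then have "{sdepth_decomposition D | D. stanley_decomposition X (poly_space A :: ('v, 'k) mpoly set) D} \<noteq> {}"
    using stanley_decomposition_of_partition by blast
  from Max_in[OF finite_sdepths[OF X A] this]
  obtain D where D: "stanley_decomposition X (poly_space A :: ('v, 'k) mpoly set) D"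
    "sdepth X (poly_space A :: ('v, 'k) mpoly set) = sdepth_decomposition D"
    unfolding sdepth_def by blast
  have "finite D" using D(1) by (simp add: stanley_decomposition_def)
  then have "sdepth_decomposition D \<le> card Z" if "(u, Z) \<in> D" for u Z
    unfolding sdepth_decomposition_def using that by (intro Min_le) force+
  then have "\<forall>(a, Z) \<in> (\<lambda>(u, Z). (the_elem (Poly_Mapping.keys u), Z)) ` {(u, Z) \<in> D. u \<noteq> 0}.
      sdepth_decomposition D \<le> card Z" by auto
  then show ?thesis
    using stanley_partition_of_decomposition[OF D(1)] unfolding stanley_depth_ge_def D(2) by blast
qed

section \<open>Connected components\<close>

lemma edge_pow_nonempty: "R \<noteq> {} \<Longrightarrow> edge_pow X R k \<noteq> {}"
proof (induction k)
  case 0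
  show ?case unfolding edge_pow.simps using zero_monomials[of X] by blast
next
  case (Suc k)
  then obtain a u v where "a \<in> edge_pow X R k" "(u, v) \<in> R" by auto
  then show ?case using edge_pow_SucI[of a X R k u v] by blast
qed

lemma bipartite_conv: "bipartite C \<longleftrightarrow> (\<exists>A B. bipartition (arcs_ends C) A B \<and> A \<union> B = verts C)"
proof -
  have "(\<forall>u v. u \<rightarrow>\<^bsub>C\<^esub> v \<longrightarrow> u \<in> A \<and> v \<in> B \<or> u \<in> B \<and> v \<in> A)
      \<longleftrightarrow> arcs_ends C \<subseteq> A \<times> B \<union> B \<times> A" for A B
    by (simp add: subset_iff)
  then show ?thesis unfolding bipartite_def bipartition_def by (simp add: conj_ac)
qed

lemma arcs_ends_subset: "wf_digraph G \<Longrightarrow> arcs_ends G \<subseteq> verts G \<times> verts G"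
  by (auto simp: arcs_ends_conv wf_digraph_def)

lemma (in sym_digraph) verts_conv_sccs: "verts G = (\<Union>C\<in>sccs. verts C)"
  using arg_cong[OF graph_is_union_sccs, of verts] by (simp add: Union_def)

lemma induced_subgraph_tail_head:
  "induced_subgraph C G \<Longrightarrow> tail C = tail G \<and> head C = head G"
  by (auto simp: induced_subgraph_def subgraph_def compatible_def)

text \<open>Components inherit the tail and head maps of \<open>G\<close>, so the union of their arc
  sets yields the union of their adjacency relations.\<close>

lemma (in sym_digraph) arcs_ends_conv_sccs: "arcs_ends G = (\<Union>C\<in>sccs. arcs_ends C)"
proof -
  have "arcs_ends C = (\<lambda>e. (tail G e, head G e)) ` arcs C" if "C \<in> sccs" for C
    using induced_subgraph_tail_head[OF in_sccs_imp_induced[OF that]] by (simp add: arcs_ends_conv)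
  then have "(\<Union>C\<in>sccs. arcs_ends C) = (\<lambda>e. (tail G e, head G e)) ` (\<Union>C\<in>sccs. arcs C)" by auto
  also have "(\<Union>C\<in>sccs. arcs C) = arcs G"
    using arg_cong[OF graph_is_union_sccs, of arcs] by (simp add: Union_def)
  finally show ?thesis by (simp add: arcs_ends_conv)
qed

lemma (in pseudo_graph) stanley_depth_ge_bipartite_components:
  shows "stanley_depth_ge (verts G) (edge_layer (verts G) (arcs_ends G) k) (card (bipartite_components G))"
    and "stanley_depth_ge (verts G) (edge_pow (verts G) (arcs_ends G) k) (card (bipartite_components G))"
proof -
  \<comment> \<open>Components are determined by their vertex sets, of which there are finitely
    many.\<close>
  have "finite sccs"
    using finite_sccs_verts inj_on_verts_sccs by (metis finite_imageD sccs_verts_conv)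
  moreover have "disjoint_family_on verts sccs"
    unfolding disjoint_family_on_def using scc_disj by blast
  moreover have "finite (verts C) \<and> verts C \<noteq> {} \<and> arcs_ends C \<subseteq> verts C \<times> verts C" if "C \<in> sccs" for C
  proof -
    have "subgraph C G" "strongly_connected C"
      using that by (auto simp: sccs_def induced_subgraph_def)
    then have "verts C \<subseteq> verts G" "wf_digraph C" "verts C \<noteq> {}"
      by (auto simp: subgraph_def strongly_connected_def)
    then show ?thesis using arcs_ends_subset finite_subset[OF _ finite_verts] by auto
  qed
  ultimately show
    "stanley_depth_ge (verts G) (edge_layer (verts G) (arcs_ends G) k) (card (bipartite_components G))"
    "stanley_depth_ge (verts G) (edge_pow (verts G) (arcs_ends G) k) (card (bipartite_components G))"
    using stanley_depth_ge_components[of sccs verts arcs_ends k]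
    unfolding verts_conv_sccs[symmetric] arcs_ends_conv_sccs[symmetric]
      bipartite_components_def bipartite_conv by auto
qed

theorem theorem3p1:
  fixes G H :: "('v, 'e) pre_digraph"
    and I J :: "('v, 'k::field) mpoly set"
    and h k :: nat
  assumes "graph G"
    and "I = edge_ideal G"
    and "H \<in> pre_digraph.sccs G"
    and "arcs H \<noteq> {}"
    and "J = edge_ideal H"
    and "h = card (bipartite_components (remove_verts G (verts H)))"
    and "k \<ge> 1"
  shows "sdepth (verts G) (ideal_power (verts G) I k)
    \<ge> Min ((\<lambda>l. sdepth (verts H) (ideal_power (verts H) J l)) ` {1..k}) + h"
proof -
  interpret G: graph G by (rule assms(1))
  define G' where "G' = remove_verts G (verts H)"
  let ?X = "verts H" and ?Y = "verts G'" and ?R = "arcs_ends H" and ?Q = "arcs_ends G'"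
  let ?A = "edge_pow ?X ?R"
  define d where "d = Min ((\<lambda>l. sdepth ?X (ideal_power ?X J l)) ` {1..k})"
  have H: "induced_subgraph H G" using assms(3) by (rule G.in_sccs_imp_induced)
  have "wf_digraph H" "?X \<subseteq> verts G" using H by (auto simp: induced_subgraph_def subgraph_def)
  have Y: "?Y = verts G - ?X" by (simp add: G'_def remove_verts_def)
  have G': "induced_subgraph G' G" unfolding G'_def remove_verts_def by (rule G.induced_induce) blast
  then have "wf_digraph G'" by (simp add: induced_subgraph_def subgraph_def)
  have pseudo: "pseudo_graph G'"
    using G.induced_graph_imp_graph[OF G'] G.fin_digraph_subgraph[of G'] G'
    by (intro pseudo_graph.intro) (simp_all add: induced_subgraph_def)
  have fin: "finite ?X" "finite ?Y"
    using finite_subset[OF \<open>?X \<subseteq> verts G\<close>] by (simp_all add: Y)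
  have disj: "?X \<inter> ?Y = {}" and Un: "?X \<union> ?Y = verts G" using Y \<open>?X \<subseteq> verts G\<close> by auto
  have R: "?R \<subseteq> ?X \<times> ?X" by (rule arcs_ends_subset) fact
  have Q: "?Q \<subseteq> ?Y \<times> ?Y" by (rule arcs_ends_subset) fact
  \<comment> \<open>Every edge lies inside one component, so an edge not in \<open>H\<close> has
    both ends outside \<open>verts H\<close> and survives in the induced subgraph.\<close>
  have ends: "arcs_ends G = ?R \<union> ?Q"
  proof (intro equalityI subsetI)
    fix e assume e: "e \<in> arcs_ends G"
    then obtain C where C: "C \<in> G.sccs" "e \<in> arcs_ends C" using G.arcs_ends_conv_sccs by blast
    show "e \<in> ?R \<union> ?Q"
    proof (cases "C = H")
      case False
      then have "verts C \<inter> ?X = {}" using G.scc_disj[OF C(1) assms(3)] by blast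
      moreover have "wf_digraph C" "verts C \<subseteq> verts G"
        using G.in_sccs_imp_induced[OF C(1)] by (auto simp: induced_subgraph_def subgraph_def)
      ultimately have "e \<in> ?Y \<times> ?Y" using arcs_ends_subset[of C] C(2) unfolding Y by blast
      then have "e \<in> ?Q" using e by (auto simp: arcs_ends_conv G'_def remove_verts_def)
      then show ?thesis by blast
    qed (use C in blast)
  next
    fix e assume "e \<in> ?R \<union> ?Q"
    then show "e \<in> arcs_ends G"
      using arcs_ends_mono[of H G] arcs_ends_mono[of G' G] H G' by (auto simp: induced_subgraph_def)
  qed
  have "?R \<noteq> {}" using assms(4) by (simp add: arcs_ends_def)
  then have "?X \<noteq> {}" using R by auto
  have J: "ideal_power ?X J l = poly_space (?A l)" for l
    unfolding assms(5) edge_ideal_conv[OF \<open>wf_digraph H\<close>] by (rule ideal_power_conv[OF R])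
  have ge: "stanley_depth_ge ?X (?A l) d" if "1 \<le> l" "l \<le> k" for l
  proof (rule stanley_depth_ge_mono)
    show "stanley_depth_ge ?X (?A l) (sdepth ?X (poly_space (?A l) :: ('v, 'k) mpoly set))"
      by (rule stanley_depth_ge_sdepth[OF fin(1) edge_pow_nonempty[OF \<open>?R \<noteq> {}\<close>]
            stanley_depth_ge_edge_pow[OF fin(1) \<open>?X \<noteq> {}\<close> R]])
    show "d \<le> sdepth ?X (poly_space (?A l) :: ('v, 'k) mpoly set)"
      unfolding d_def J[symmetric] using that by (intro Min_le) auto
  qed
  \<comment> \<open>Since k \<ge> 1, the power l = 1 occurs in the minimum, and its ideal is nonzero
    because \<open>H\<close> has an edge.\<close>
  have "d \<le> card ?X"
    by (rule stanley_depth_ge_le_card[OF fin(1) edge_pow_nonempty[OF \<open>?R \<noteq> {}\<close>] ge[of 1]])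
      (use assms(7) in auto)
  then have "stanley_depth_ge (?X \<union> ?Y) (edge_pow (?X \<union> ?Y) (?R \<union> ?Q) k) (d + h)"
    unfolding assms(6) G'_def[symmetric]
    by (intro stanley_depth_ge_edge_pow_Un fin disj R Q ge pseudo_graph.stanley_depth_ge_bipartite_components[OF pseudo])
  then have "stanley_depth_ge (verts G) (edge_pow (verts G) (arcs_ends G) k) (d + h)"
    unfolding Un ends .
  moreover have "edge_pow (verts G) (arcs_ends G) k \<noteq> {}"
    using \<open>?R \<noteq> {}\<close> ends by (intro edge_pow_nonempty) auto
  ultimately have "d + h \<le> sdepth (verts G)
      (poly_space (edge_pow (verts G) (arcs_ends G) k) :: ('v, 'k) mpoly set)"
    by (intro sdepth_ge) auto
  also have "poly_space (edge_pow (verts G) (arcs_ends G) k) = ideal_power (verts G) I k"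
    unfolding assms(2) edge_ideal_conv[OF G.wf_digraph]
    by (rule ideal_power_conv[OF arcs_ends_subset[OF G.wf_digraph], symmetric])
  finally show ?thesis unfolding d_def .
qed

end
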